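(* Let $p_-<0<p_+$ and $\lambda_-,\lambda_+>0$. Let $(X,E)$ be the piecewise deterministic process on $\mathbb{R}\times I$, $I=\{-1,1\}$, obtained by switching between $f_{-1}(x)=p_-x-x^2$ and $f_1(x)=p_+x-x^2$, with constant rate $\lambda_-$ of switching from $f_{-1}$ to $f_1$ and constant rate $\lambda_+$ of switching from $f_1$ to $f_{-1}$. For $b<p_-$ let $\tau_b=\inf\{t\ge0:X_t\le b\}$. Let $a\le p_--2$, let $\nu$ be a probability measure on $\mathbb{R}\times I$ with $\nu((-\infty,0)\times I)=1$, and let $\nu\mathsf{P}^{\tau_a}$ denote the law of $(X,E)$ with initial distribution $\nu$ and stopped at time $\tau_a$. Then: 1. If $\frac{\lambda_+}{p_+}<-\frac{\lambda_-}{p_-}$, then $\nu\mathsf{P}^{\tau_a}(\tau_{p_--1}<\infty)=1$. 2. If $\frac{\lambda_+}{p_+}>-\frac{\lambda_-}{p_-}$ and $\nu((p_-,0)\times I)>0$, then $\nu\mathsf{P}^{\tau_a}(\tau_{p_--1}<\infty)<1$ and $$\nu\mathsf{P}^{\tau_a}\left(\{\tau_{p_--1}<\infty\}\cup\left\{\lim_{t\to\infty}X_t=0\right\}\right)=1.$$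
   Context: The process $(X,E)$: $E=(E_t)_{t\ge0}$ is the continuous-time Markov chain on $I=\{-1,1\}$ that jumps from $-1$ to $1$ at rate $\lambda_-$ and from $1$ to $-1$ at rate $\lambda_+$ (rates independent of $X$), and $X$ solves $X_t=X_0+\int_0^t f_{E_s}(X_s)\,ds$. The vector fields are not forward complete (trajectories may go to $-\infty$ in finite time), but $(X,E)$ stopped at $\tau_a$, i.e. $(X_{t\wedge\tau_a},E_{t\wedge\tau_a})_{t\ge0}$, is well defined for all times. Convention: $\inf\emptyset=\infty$. *)

theory Defs
  imports "HOL-Probability.Probability"
begin

definition switched_field :: "real \<Rightarrow> real \<Rightarrow> int \<Rightarrow> real \<Rightarrow> real" where
  "switched_field pm pp i x = (if i = -1 then pm * x - x^2 else pp * x - x^2)"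

definition rate :: "real \<Rightarrow> real \<Rightarrow> int \<Rightarrow> real" where
  "rate lm lp i = (if i = -1 then lm else lp)"

abbreviation state_space :: "(real \<times> int) measure" where
  "state_space \<equiv> borel \<Otimes>\<^sub>M count_space {-1, 1}"

text \<open>In \<^typ>\<open>ereal\<close> the infimum of the empty set is \<open>\<infinity>\<close>.\<close>

definition hitting_time :: "real \<Rightarrow> (real \<Rightarrow> real) \<Rightarrow> ereal" where
  "hitting_time b x = Inf (ereal ` {t. 0 \<le> t \<and> x t \<le> b})"

text \<open>
  The chain on \<open>{-1, 1}\<close> is given by its jump chain and holding times: the jumps alternate, so the
  state after \<open>n\<close> jumps is \<open>(-1)^n i\<close> when the chain starts in \<open>i\<close>, and for independent
  standard exponential \<open>s k\<close> the holding time \<open>s k / rate lm lp j\<close> in state \<open>j\<close> is exponential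
  with parameter \<open>rate lm lp j\<close>.
\<close>

definition jump_time :: "real \<Rightarrow> real \<Rightarrow> int \<Rightarrow> (nat \<Rightarrow> real) \<Rightarrow> nat \<Rightarrow> real" where
  "jump_time lm lp i s n = (\<Sum>k<n. s k / rate lm lp ((-1)^k * i))"

definition switching_path ::
  "real \<Rightarrow> real \<Rightarrow> (nat \<Rightarrow> real) \<Rightarrow> (real \<Rightarrow> int) \<Rightarrow> bool" where
  "switching_path lm lp s e \<longleftrightarrow>
     (\<forall>n t. jump_time lm lp (e 0) s n \<le> t \<and> t < jump_time lm lp (e 0) s (Suc n) \<longrightarrow>
            e t = (-1)^n * e 0)"

text \<open>
  An unstopped solution may reach \<open>-\<infinity>\<close> in finite time, so the integral equation is stated for the
  stopped path \<open>x\<close> itself, that is, with the integral taken up to \<open>min t \<tau>\<^sub>a\<close>. Until it hits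
  \<open>{..a}\<close> the path \<open>x\<close> solves the unstopped equation; from then on it is constant. The hitting
  times of levels \<open>b \<ge> a\<close> are the same for the stopped and the unstopped path.
\<close>

definition stopped_solution ::
  "real \<Rightarrow> real \<Rightarrow> real \<Rightarrow> (real \<Rightarrow> int) \<Rightarrow> (real \<Rightarrow> real) \<Rightarrow> bool" where
  "stopped_solution pm pp a e x \<longleftrightarrow>
     (\<forall>t\<ge>0. ((\<lambda>s. switched_field pm pp (e s) (x s)) has_integral (x t - x 0))
              {0..real_of_ereal (min (ereal t) (hitting_time a x))})"

text \<open>
  A realisation, on an arbitrary probability space, of the switched process with initial
  distribution \<open>\<nu>\<close>, where \<open>X\<close> is already stopped at \<open>\<tau>\<^sub>a\<close> and \<open>E\<close> is the unstopped chain. The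
  equation in \<open>joint_law\<close> says that \<open>(X 0, E 0)\<close> has law \<open>\<nu>\<close> and that the variables \<open>S n\<close> are
  independent of each other and of \<open>(X 0, E 0)\<close> and standard exponential.
\<close>

locale stopped_switched_process = prob_space M
  for M :: "'w measure" +
  fixes pm pp lm lp a :: real
    and \<nu> :: "(real \<times> int) measure"
    and X :: "real \<Rightarrow> 'w \<Rightarrow> real"
    and E :: "real \<Rightarrow> 'w \<Rightarrow> int"
  assumes X_measurable: "0 \<le> t \<Longrightarrow> X t \<in> borel_measurable M"
    and E_measurable: "0 \<le> t \<Longrightarrow> E t \<in> M \<rightarrow>\<^sub>M count_space {-1, 1}"
    and X_continuous: "\<omega> \<in> space M \<Longrightarrow> continuous_on {0..} (\<lambda>t. X t \<omega>)"
    and joint_law: "\<exists>S. (\<forall>n. S n \<in> borel_measurable M) \<and>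
      distr M (state_space \<Otimes>\<^sub>M PiM UNIV (\<lambda>n::nat. borel))
        (\<lambda>\<omega>. ((X 0 \<omega>, E 0 \<omega>), \<lambda>n. S n \<omega>))
      = \<nu> \<Otimes>\<^sub>M PiM UNIV (\<lambda>n::nat. density lborel (exponential_density 1)) \<and>
      (AE \<omega> in M. switching_path lm lp (\<lambda>n. S n \<omega>) (\<lambda>t. E t \<omega>))"
    and X_solution: "AE \<omega> in M. stopped_solution pm pp a (\<lambda>t. E t \<omega>) (\<lambda>t. X t \<omega>)"

end

theory Submission
  imports Defs
begin

text \<open>
  Let \<open>p\<^sub>i\<close> be the linear coefficient of the field \<open>i\<close>, let \<open>A\<^sub>t\<close> be the integral of \<open>p\<close> along the
  chain up to time \<open>t\<close>, and let \<open>Z = - 1 / X\<close>. The Bernoulli equation becomes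
  \<open>(exp A Z)' = - exp A\<close>, so \<open>X\<close> can only escape to \<open>-\<infinity>\<close> when the integral of \<open>exp A\<close> exceeds
  \<open>Z\<^sub>0\<close>. At jump times \<open>A\<close> is a sum of independent exponential variables with alternating
  coefficients, and exponential moments show that it tends to \<open>\<plusminus>\<infinity>\<close> almost surely according to the
  sign of \<open>p\<^sub>- / \<lambda>\<^sub>- + p\<^sub>+ / \<lambda>\<^sub>+\<close>, with \<open>exp A\<close> summable over the jump times if this is negative.

  If the sign is positive, the integral diverges and the level \<open>p\<^sub>- - 1\<close> is hit. If it is negative,
  the integral \<open>I\<close> is finite: for \<open>I < Z\<^sub>0\<close> the path stays above \<open>p\<^sub>-\<close> and tends to \<open>0\<close>, for
  \<open>I > Z\<^sub>0\<close> the level is hit, and \<open>I = Z\<^sub>0\<close> has probability zero because, given all other holding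
  times, \<open>I\<close> is an injective function of the first holding time in state \<open>1\<close>. Finally, for
  every \<open>c > 1 / \<bar>p\<^sub>-\<bar>\<close>, a long first sojourn in state \<open>-1\<close> gives \<open>I < c\<close> with positive
  probability, so the level is missed with positive probability from \<open>X\<^sub>0 > p\<^sub>-\<close>.
\<close>

section \<open>Sequences of exponential variables\<close>

abbreviation std_exp :: "real measure" where
  "std_exp \<equiv> density lborel (exponential_density 1)"

abbreviation exp_seq :: "(nat \<Rightarrow> real) measure" where
  "exp_seq \<equiv> PiM UNIV (\<lambda>n. std_exp)"

lemma prob_space_std_exp: "prob_space std_exp"
  by (rule prob_space_exponential_density) simp

interpretation std_exp: prob_space std_exp
  by (rule prob_space_std_exp)

interpretation exp_seq: sequence_space std_exp
  by unfold_locales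

interpretation std_exp_pair: pair_prob_space std_exp exp_seq
  by unfold_locales

lemma sets_exp_seq [measurable_cong]: "sets exp_seq = sets (PiM UNIV (\<lambda>_::nat. borel :: real measure))"
  by (rule sets_PiM_cong) simp_all

lemma exp_seq_iter: "distr (std_exp \<Otimes>\<^sub>M exp_seq) exp_seq (\<lambda>(t, s). case_nat t s) = exp_seq"
  by (rule exp_seq.PiM_iter)

lemma measurable_case_nat_exp_seq [measurable]:
  "(\<lambda>(t, s). case_nat t s) \<in> std_exp \<Otimes>\<^sub>M exp_seq \<rightarrow>\<^sub>M exp_seq"
  by measurable

lemma AE_exp_seq_iter:
  assumes [measurable]: "Measurable.pred exp_seq P"
  shows "(AE s in exp_seq. P s) \<longleftrightarrow> (AE t in std_exp. AE s in exp_seq. P (case_nat t s))"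
proof -
  have "(AE s in exp_seq. P s) \<longleftrightarrow> (AE s in distr (std_exp \<Otimes>\<^sub>M exp_seq) exp_seq (\<lambda>(t, s). case_nat t s). P s)"
    by (simp only: exp_seq_iter)
  also have "\<dots> \<longleftrightarrow> (AE z in std_exp \<Otimes>\<^sub>M exp_seq. P (case z of (t, s) \<Rightarrow> case_nat t s))"
    by (rule AE_distr_iff) measurable
  also have "\<dots> \<longleftrightarrow> (AE t in std_exp. AE s in exp_seq. P (case_nat t s))"
    unfolding case_prod_beta by (rule std_exp_pair.AE_pair_iff[symmetric]) measurable
  finally show ?thesis .
qed

text \<open>For arguments that vary the first holding time while all later ones are frozen.\<close>

lemma AE_exp_seq_iter':
  assumes [measurable]: "Measurable.pred exp_seq P"
  shows "(AE s in exp_seq. P s) \<longleftrightarrow> (AE s in exp_seq. AE t in std_exp. P (case_nat t s))"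
  unfolding AE_exp_seq_iter[OF assms]
  by (rule std_exp_pair.AE_commute) measurable

lemma nn_integral_exp_seq_iter:
  assumes [measurable]: "f \<in> borel_measurable exp_seq"
  shows "(\<integral>\<^sup>+ s. f s \<partial>exp_seq) = (\<integral>\<^sup>+ t. \<integral>\<^sup>+ s. f (case_nat t s) \<partial>exp_seq \<partial>std_exp)"
proof -
  have "(\<integral>\<^sup>+ s. f s \<partial>exp_seq) = (\<integral>\<^sup>+ s. f s \<partial>distr (std_exp \<Otimes>\<^sub>M exp_seq) exp_seq (\<lambda>(t, s). case_nat t s))"
    by (simp only: exp_seq_iter)
  also have "\<dots> = (\<integral>\<^sup>+ z. f (case_nat (fst z) (snd z)) \<partial>(std_exp \<Otimes>\<^sub>M exp_seq))"
    by (subst nn_integral_distr) (auto simp: case_prod_beta)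
  also have "\<dots> = (\<integral>\<^sup>+ t. \<integral>\<^sup>+ s. f (case_nat t s) \<partial>exp_seq \<partial>std_exp)"
    by (subst exp_seq.nn_integral_fst[symmetric]) auto
  finally show ?thesis .
qed

text \<open>Tilting: \<open>exp (c * t)\<close> times the standard density is
  \<open>1 / (1 - c)\<close> times the exponential density with parameter \<open>1 - c\<close>,
  which has mass one.\<close>

lemma std_exp_moment:
  assumes "c < 1"
  shows "(\<integral>\<^sup>+ t. ennreal (exp (c * t)) \<partial>std_exp) = ennreal (1 / (1 - c))"
proof -
  interpret P: prob_space "density lborel (exponential_density (1 - c))"
    using assms by (intro prob_space_exponential_density) simp
  have "(\<integral>\<^sup>+ t. ennreal (exp (c * t)) \<partial>std_exp)
      = (\<integral>\<^sup>+ t. ennreal (exponential_density 1 t) * ennreal (exp (c * t)) \<partial>lborel)"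
    by (subst nn_integral_density) auto
  also have "\<dots> = (\<integral>\<^sup>+ t. ennreal (1 / (1 - c)) * ennreal (exponential_density (1 - c) t) \<partial>lborel)"
    using assms
    by (intro nn_integral_cong)
       (auto simp: exponential_density_def ennreal_mult[symmetric] exp_add[symmetric] field_simps)
  also have "\<dots> = ennreal (1 / (1 - c)) * (\<integral>\<^sup>+ t. ennreal (exponential_density (1 - c) t) \<partial>lborel)"
    by (rule nn_integral_cmult) simp
  also have "(\<integral>\<^sup>+ t. ennreal (exponential_density (1 - c) t) \<partial>lborel) = 1"
    using P.emeasure_space_1 by (simp add: emeasure_density)
  finally show ?thesis by simp
qed

lemma AE_std_exp_iff:
  "(AE t in std_exp. P t) \<longleftrightarrow> (AE t in lborel. 0 \<le> t \<longrightarrow> P t)"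
  by (subst AE_density) (auto simp: exponential_density_def not_less)

lemma AE_std_exp_neq: "AE t in std_exp. t \<noteq> c"
  unfolding AE_std_exp_iff using AE_lborel_singleton[of c] by eventually_elim simp

lemma AE_std_exp_pos: "AE t in std_exp. 0 < t"
  unfolding AE_std_exp_iff using AE_lborel_singleton[of 0] by eventually_elim simp

text \<open>The density is positive on the half-line, so no interval in it is null. This turns
  almost sure properties of a holding time into witnesses.\<close>

lemma AE_std_exp_between:
  assumes "AE t in std_exp. P t" "0 \<le> u" "u < v"
  obtains t where "u < t" "t < v" "P t"
proof -
  have "\<not> (AE t in lborel. t \<notin> {u<..<v})"
  proof
    assume "AE t in lborel. t \<notin> {u<..<v}"
    then have "emeasure lborel {u<..<v} = 0"
      by (subst (asm) AE_iff_measurable[of "{u<..<v}"]) auto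
    then show False using \<open>u < v\<close> by simp
  qed
  moreover have "AE t in lborel. t \<notin> {u<..<v}" if "\<And>t. u < t \<Longrightarrow> t < v \<Longrightarrow> \<not> P t"
    using assms(1) unfolding AE_std_exp_iff by eventually_elim (use that \<open>0 \<le> u\<close> in force)
  ultimately show ?thesis using that by blast
qed

lemma AE_exp_seq_pos: "AE s in exp_seq. \<forall>k. 0 < s k"
  unfolding AE_all_countable
  by (intro allI AE_PiM_component prob_space_std_exp AE_std_exp_pos) auto

section \<open>Alternating sums of exponential variables and their moments\<close>

definition alternating_sum :: "real \<Rightarrow> real \<Rightarrow> (nat \<Rightarrow> real) \<Rightarrow> nat \<Rightarrow> real" where
  "alternating_sum \<alpha> \<beta> s n = (\<Sum>k<n. (if even k then \<alpha> else \<beta>) * s k)"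

lemma alternating_sum_0 [simp]: "alternating_sum \<alpha> \<beta> s 0 = 0"
  by (simp add: alternating_sum_def)

lemma alternating_sum_case_nat:
  "alternating_sum \<alpha> \<beta> (case_nat t s) (Suc n) = \<alpha> * t + alternating_sum \<beta> \<alpha> s n"
proof -
  have "(\<Sum>i<n. (if odd i then \<alpha> else \<beta>) * s i) = (\<Sum>i<n. (if even i then \<beta> else \<alpha>) * s i)"
    by (rule sum.cong) auto
  then show ?thesis
    by (simp add: alternating_sum_def sum.lessThan_Suc_shift del: sum.lessThan_Suc)
qed

lemma measurable_alternating_sum [measurable]:
  "(\<lambda>s. alternating_sum \<alpha> \<beta> s n) \<in> borel_measurable (PiM UNIV (\<lambda>_::nat. borel))"
  unfolding alternating_sum_def by measurable

text \<open>The product x y x y ... with \<open>n\<close> factors. The recursion swaps its arguments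
  just as removing the first variable swaps the coefficients of the alternating sum.\<close>

fun alternating_prod :: "real \<Rightarrow> real \<Rightarrow> nat \<Rightarrow> real" where
  "alternating_prod x y 0 = 1"
| "alternating_prod x y (Suc n) = x * alternating_prod y x n"

lemma alternating_prod_nonneg: "0 \<le> x \<Longrightarrow> 0 \<le> y \<Longrightarrow> 0 \<le> alternating_prod x y n"
  by (induction n arbitrary: x y) auto

text \<open>Two consecutive factors multiply to \<open>x * y\<close>, so the products decay
  geometrically with ratio \<open>sqrt (x * y)\<close>.\<close>

lemma summable_alternating_prod:
  assumes "0 < x" "0 < y" "x * y < 1"
  shows "summable (alternating_prod x y)"
proof -
  define q where "q = sqrt (x * y)"
  have q: "0 < q" "q < 1" "q * q = x * y"
    using assms by (auto simp: q_def)
  \<comment> \<open>Dictated by the two base cases: 1 for no factor, \<open>x / q\<close> for one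
    factor.\<close>
  define K where "K = max 1 (x / q)"
  have bound: "alternating_prod x y n \<le> K * q ^ n" for n
  proof (induction n rule: induct_nat_012)
    case 0
    then show ?case by (simp add: K_def)
  next
    case 1
    have "x / q * q \<le> K * q"
      using q by (intro mult_right_mono) (auto simp: K_def)
    then show ?case using q by simp
  next
    case (ge2 n)
    have "alternating_prod x y (Suc (Suc n)) = q * q * alternating_prod x y n"
      by (simp add: q)
    also have "\<dots> \<le> q * q * (K * q ^ n)"
      by (rule mult_left_mono[OF ge2(1)]) simp
    finally show ?case by (simp add: algebra_simps)
  qed
  have "summable (\<lambda>n. K * q ^ n)"
    using q by (intro summable_mult summable_geometric) auto
  then show ?thesis
    by (rule summable_comparison_test'[where N = 0])
      (use assms bound in \<open>simp add: alternating_prod_nonneg\<close>)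
qed

text \<open>By independence the moment factorises; the bounds on \<alpha> and \<beta> keep every
  factor finite.\<close>

lemma alternating_sum_moment:
  assumes "\<alpha> < 1" "\<beta> < 1"
  shows "(\<integral>\<^sup>+ s. ennreal (exp (alternating_sum \<alpha> \<beta> s n)) \<partial>exp_seq)
    = ennreal (alternating_prod (1 / (1 - \<alpha>)) (1 / (1 - \<beta>)) n)"
  using assms
proof (induction n arbitrary: \<alpha> \<beta>)
  case 0
  then show ?case by (simp add: exp_seq.P.emeasure_space_1)
next
  case (Suc n)
  have "(\<integral>\<^sup>+ s. ennreal (exp (alternating_sum \<alpha> \<beta> s (Suc n))) \<partial>exp_seq)
    = (\<integral>\<^sup>+ t. \<integral>\<^sup>+ s. ennreal (exp (\<alpha> * t)) * ennreal (exp (alternating_sum \<beta> \<alpha> s n)) \<partial>exp_seq \<partial>std_exp)"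
    by (subst nn_integral_exp_seq_iter)
       (auto simp: alternating_sum_case_nat exp_add ennreal_mult)
  also have "\<dots> = (\<integral>\<^sup>+ t. ennreal (exp (\<alpha> * t)) \<partial>std_exp)
      * ennreal (alternating_prod (1 / (1 - \<beta>)) (1 / (1 - \<alpha>)) n)"
    by (subst nn_integral_cmult, simp, subst Suc.IH) (use Suc.prems in \<open>auto simp: nn_integral_multc\<close>)
  also have "\<dots> = ennreal (alternating_prod (1 / (1 - \<alpha>)) (1 / (1 - \<beta>)) (Suc n))"
    using Suc.prems
    by (simp add: std_exp_moment ennreal_mult[symmetric] alternating_prod_nonneg)
  finally show ?case .
qed

text \<open>The product expands to \<open>1 + \<theta> * (- (\<alpha> + \<beta>) + \<theta> *
  (\<alpha> * \<beta>))\<close>, and the bracket is positive for small positive \<theta>. The last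
  inequality makes the tilted moments summable.\<close>

lemma exists_contracting_tilt:
  fixes \<alpha> \<beta> :: real
  assumes "\<alpha> + \<beta> < 0"
  obtains \<theta> where "0 < \<theta>" "\<theta> \<le> 1" "\<theta> * \<alpha> < 1" "\<theta> * \<beta> < 1" "1 < (1 - \<theta> * \<alpha>) * (1 - \<theta> * \<beta>)"
proof -
  have "((\<lambda>\<theta>. \<theta> * \<alpha>) \<longlongrightarrow> 0 * \<alpha>) (at_right 0)" "((\<lambda>\<theta>. \<theta> * \<beta>) \<longlongrightarrow> 0 * \<beta>) (at_right 0)"
     "((\<lambda>\<theta>. - (\<alpha> + \<beta>) + \<theta> * (\<alpha> * \<beta>)) \<longlongrightarrow> - (\<alpha> + \<beta>) + 0 * (\<alpha> * \<beta>)) (at_right 0)"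
    by (intro tendsto_intros)+
  then have "\<forall>\<^sub>F \<theta> in at_right 0. \<theta> * \<alpha> < 1" "\<forall>\<^sub>F \<theta> in at_right 0. \<theta> * \<beta> < 1"
    "\<forall>\<^sub>F \<theta> in at_right 0. 0 < - (\<alpha> + \<beta>) + \<theta> * (\<alpha> * \<beta>)"
    using assms by (auto intro: order_tendstoD)
  moreover have "\<forall>\<^sub>F \<theta> in at_right 0. \<theta> < (1::real)" "\<forall>\<^sub>F \<theta> in at_right 0. (0::real) < \<theta>"
    by (auto simp: eventually_at_right_less intro: eventually_at_rightI[of 0 1])
  ultimately have "\<forall>\<^sub>F \<theta> in at_right 0. \<theta> * \<alpha> < 1 \<and> \<theta> * \<beta> < 1 \<and> 0 < - (\<alpha> + \<beta>) + \<theta> * (\<alpha> * \<beta>) \<and> \<theta> < 1 \<and> 0 < \<theta>"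
    by eventually_elim auto
  then obtain \<theta> where \<theta>: "\<theta> * \<alpha> < 1" "\<theta> * \<beta> < 1" "0 < - (\<alpha> + \<beta>) + \<theta> * (\<alpha> * \<beta>)" "\<theta> < 1" "0 < \<theta>"
    using eventually_happens trivial_limit_at_right_real by blast
  have "0 < \<theta> * (- (\<alpha> + \<beta>) + \<theta> * (\<alpha> * \<beta>))" using \<theta> by simp
  then show ?thesis using \<theta> by (intro that[of \<theta>]) (auto simp: algebra_simps)
qed

text \<open>A tilt \<open>\<theta> \<le> 1\<close> suffices: once the sums are negative, \<open>exp\<close> of the sum is at most \<open>exp\<close> of \<open>\<theta>\<close>
  times the sum.\<close>

lemma AE_summable_exp_alternating_sum:
  assumes "\<alpha> + \<beta> < 0"
  shows "AE s in exp_seq. summable (\<lambda>n. exp (alternating_sum \<alpha> \<beta> s n))"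
proof -
  obtain \<theta> where \<theta>: "0 < \<theta>" "\<theta> \<le> 1" "\<theta> * \<alpha> < 1" "\<theta> * \<beta> < 1" "1 < (1 - \<theta> * \<alpha>) * (1 - \<theta> * \<beta>)"
    using exists_contracting_tilt[OF assms] .
  let ?f = "\<lambda>s n. exp (alternating_sum (\<theta> * \<alpha>) (\<theta> * \<beta>) s n)"
  let ?p = "alternating_prod (1 / (1 - \<theta> * \<alpha>)) (1 / (1 - \<theta> * \<beta>))"
  have "summable ?p"
    using \<theta> by (intro summable_alternating_prod) auto
  have "(\<integral>\<^sup>+ s. (\<Sum>n. ennreal (?f s n)) \<partial>exp_seq) = (\<Sum>n. ennreal (?p n))"
    using \<theta> by (subst nn_integral_suminf) (auto simp: alternating_sum_moment)
  also have "\<dots> \<noteq> \<infinity>"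
    using \<open>summable ?p\<close> \<theta>
    by (subst suminf_ennreal2) (auto intro: alternating_prod_nonneg)
  finally have "AE s in exp_seq. (\<Sum>n. ennreal (?f s n)) \<noteq> \<infinity>"
    by (intro nn_integral_PInf_AE) auto
  then show ?thesis
  proof eventually_elim
    case (elim s)
    then have sum: "summable (?f s)"
      by (intro summable_suminf_not_top) auto
    have eq: "?f s n = exp (\<theta> * alternating_sum \<alpha> \<beta> s n)" for n
      by (auto simp: alternating_sum_def sum_distrib_left intro!: sum.cong)
    have "?f s \<longlonglongrightarrow> 0" using sum by (rule summable_LIMSEQ_zero)
    then have "\<forall>\<^sub>F n in sequentially. ?f s n < 1" by (rule order_tendstoD) simp
    then have "\<forall>\<^sub>F n in sequentially. norm (exp (alternating_sum \<alpha> \<beta> s n)) \<le> ?f s n"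
    proof eventually_elim
      case (elim n)
      then have "alternating_sum \<alpha> \<beta> s n < 0" using \<theta> by (simp add: eq mult_less_0_iff)
      then have "1 * alternating_sum \<alpha> \<beta> s n \<le> \<theta> * alternating_sum \<alpha> \<beta> s n"
        using \<theta> by (intro mult_right_mono_neg) auto
      then show ?case by (simp add: eq)
    qed
    then show ?case using sum by (rule summable_comparison_test_ev)
  qed
qed

section \<open>The exponential functional\<close>

text \<open>The integral of \<open>exp\<close> of a piecewise linear exponent over one sojourn:
  increment of \<open>exp\<close> divided by the slope \<open>x\<close> or \<open>y\<close>.\<close>

definition exp_increment :: "real \<Rightarrow> real \<Rightarrow> real \<Rightarrow> real \<Rightarrow> (nat \<Rightarrow> real) \<Rightarrow> nat \<Rightarrow> real" where
  "exp_increment \<alpha> \<beta> x y s n =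
     (exp (alternating_sum \<alpha> \<beta> s (Suc n)) - exp (alternating_sum \<alpha> \<beta> s n)) / (if even n then x else y)"

text \<open>For \<open>\<alpha> = p\<^sub>i / \<lambda>\<^sub>i\<close>, \<open>x = p\<^sub>i\<close> and \<open>\<beta>\<close>, \<open>y\<close> the same in the other state, this is
  the integral of \<open>exp A\<^sub>t\<close> over \<open>t \<ge> 0\<close>, where \<open>A\<close> has slope \<open>p\<close> and the chain starts in \<open>i\<close>.\<close>

definition exp_functional :: "real \<Rightarrow> real \<Rightarrow> real \<Rightarrow> real \<Rightarrow> (nat \<Rightarrow> real) \<Rightarrow> ennreal" where
  "exp_functional \<alpha> \<beta> x y s = (\<Sum>n. ennreal (exp_increment \<alpha> \<beta> x y s n))"

lemma measurable_exp_functional [measurable]: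
  "exp_functional \<alpha> \<beta> x y \<in> borel_measurable (PiM UNIV (\<lambda>_::nat. borel))"
  unfolding exp_functional_def exp_increment_def by measurable

lemma exp_increment_0: "exp_increment \<alpha> \<beta> x y (case_nat t s) 0 = (exp (\<alpha> * t) - 1) / x"
  using alternating_sum_case_nat[of \<alpha> \<beta> t s 0] by (simp add: exp_increment_def)

lemma exp_increment_Suc:
  "exp_increment \<alpha> \<beta> x y (case_nat t s) (Suc n) = exp (\<alpha> * t) * exp_increment \<beta> \<alpha> y x s n"
  by (simp add: exp_increment_def alternating_sum_case_nat exp_add right_diff_distrib)

text \<open>Decomposition at the first jump: what follows is the functional started in the other
  state, scaled by \<open>exp (\<alpha> * t)\<close>.\<close>

lemma exp_functional_case_nat:
  "exp_functional \<alpha> \<beta> x y (case_nat t s)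
    = ennreal ((exp (\<alpha> * t) - 1) / x) + ennreal (exp (\<alpha> * t)) * exp_functional \<beta> \<alpha> y x s"
proof -
  let ?f = "\<lambda>n. ennreal (exp_increment \<alpha> \<beta> x y (case_nat t s) n)"
  have "exp_functional \<alpha> \<beta> x y (case_nat t s) = (\<Sum>n. ?f (Suc n)) + ?f 0"
    unfolding exp_functional_def
    using suminf_offset[of ?f 1] by (simp add: add.commute)
  then show ?thesis
    by (simp add: exp_increment_0 exp_increment_Suc exp_functional_def ennreal_mult' add.commute)
qed

lemma exp_diff_div_nonneg:
  fixes \<alpha> x t :: real
  assumes "0 < \<alpha> * x" "0 \<le> t"
  shows "0 \<le> (exp (\<alpha> * t) - 1) / x"
  using assms by (auto simp: zero_less_mult_iff zero_le_divide_iff mult_nonpos_nonneg)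

lemma exp_increment_nonneg:
  assumes "0 < \<alpha> * x" "0 < \<beta> * y" "0 \<le> s n"
  shows "0 \<le> exp_increment \<alpha> \<beta> x y s n"
  using exp_diff_div_nonneg[of \<alpha> x "s n"] exp_diff_div_nonneg[of \<beta> y "s n"] assms
  by (auto simp: exp_increment_def alternating_sum_def exp_add zero_le_divide_iff
      mult_le_cancel_left1 mult_le_cancel_left2)

lemma summable_exp_increment:
  assumes "summable (\<lambda>n. exp (alternating_sum \<alpha> \<beta> s n))" "x \<noteq> 0" "y \<noteq> 0"
  shows "summable (exp_increment \<alpha> \<beta> x y s)"
proof (rule summable_comparison_test')
  let ?e = "\<lambda>n. exp (alternating_sum \<alpha> \<beta> s n)"
  show "summable (\<lambda>n. (?e (Suc n) + ?e n) / min \<bar>x\<bar> \<bar>y\<bar>)"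
    using assms(1) summable_Suc_iff[of ?e]
    by (intro summable_divide summable_add) (simp_all del: summable_Suc_iff)
  show "norm (exp_increment \<alpha> \<beta> x y s n) \<le> (?e (Suc n) + ?e n) / min \<bar>x\<bar> \<bar>y\<bar>" if "0 \<le> n" for n
  proof -
    have "\<bar>?e (Suc n) - ?e n\<bar> \<le> ?e (Suc n) + ?e n"
      using exp_gt_zero[of "alternating_sum \<alpha> \<beta> s (Suc n)"] exp_gt_zero[of "alternating_sum \<alpha> \<beta> s n"]
      by linarith
    then show ?thesis
      unfolding exp_increment_def real_norm_def abs_divide
      using assms by (intro frac_le) auto
  qed
qed

lemma exp_functional_eq:
  assumes "summable (\<lambda>n. exp (alternating_sum \<alpha> \<beta> s n))" "0 < \<alpha> * x" "0 < \<beta> * y" "\<And>k. 0 \<le> s k"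
  shows "exp_functional \<alpha> \<beta> x y s = ennreal (\<Sum>n. exp_increment \<alpha> \<beta> x y s n)"
  unfolding exp_functional_def using assms
  by (intro suminf_ennreal2 exp_increment_nonneg summable_exp_increment) auto

lemma AE_exp_functional_finite:
  assumes "\<alpha> + \<beta> < 0" "0 < \<alpha> * x" "0 < \<beta> * y"
  shows "AE s in exp_seq. exp_functional \<alpha> \<beta> x y s < \<infinity>"
  using AE_summable_exp_alternating_sum[OF assms(1)] AE_exp_seq_pos
  by eventually_elim (use assms in \<open>simp add: exp_functional_eq less_imp_le\<close>)

section \<open>Absence of atoms and small values of the functional\<close>

lemma ennreal_eqD:
  fixes u c :: real
  assumes "ennreal u = ennreal c" "0 \<le> u"
  shows "u = max c 0"
  using assms by (cases "0 \<le> c") (auto simp: ennreal_neg max_def)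

text \<open>With tail value \<open>v\<close> the functional is
  \<open>exp (\<alpha> * t) * (1 / x + v) - 1 / x\<close>. For positive \<alpha> and
  \<open>x\<close> this is strictly increasing in \<open>t\<close>, so at most one holding time
  gives the value \<open>c\<close>.\<close>

lemma AE_exp_functional_neq_pos:
  assumes "0 < \<alpha>" "0 < x"
  shows "AE s in exp_seq. exp_functional \<alpha> \<beta> x y s \<noteq> ennreal c"
proof (subst AE_exp_seq_iter')
  show "AE s in exp_seq. AE t in std_exp. exp_functional \<alpha> \<beta> x y (case_nat t s) \<noteq> ennreal c"
  proof (rule AE_I2)
    fix s
    show "AE t in std_exp. exp_functional \<alpha> \<beta> x y (case_nat t s) \<noteq> ennreal c"
    proof (cases "exp_functional \<beta> \<alpha> y x s")
      case top
      then show ?thesis by (simp add: exp_functional_case_nat ennreal_mult_top)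
    next
      case (real v)
      \<comment> \<open>The only candidate. The maximum appears because \<open>ennreal\<close> maps
        negative reals to zero.\<close>
      define t0 where "t0 = ln ((max c 0 + 1 / x) / (1 / x + v)) / \<alpha>"
      show ?thesis
        using AE_std_exp_neq[of t0] AE_std_exp_pos
      proof eventually_elim
        case (elim t)
        have g: "0 \<le> (exp (\<alpha> * t) - 1) / x"
          using assms elim by (intro exp_diff_div_nonneg) auto
        have "exp_functional \<alpha> \<beta> x y (case_nat t s) = ennreal ((exp (\<alpha> * t) - 1) / x + exp (\<alpha> * t) * v)"
          using real g by (simp add: exp_functional_case_nat ennreal_mult[symmetric])
        moreover have "(exp (\<alpha> * t) - 1) / x + exp (\<alpha> * t) * v \<noteq> max c 0"
        proof
          assume "(exp (\<alpha> * t) - 1) / x + exp (\<alpha> * t) * v = max c 0"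
          then have "exp (\<alpha> * t) * (1 / x + v) = max c 0 + 1 / x"
            by (simp add: algebra_simps diff_divide_distrib)
          moreover have "0 < 1 / x + v" using assms real by (simp add: add_pos_nonneg)
          ultimately have "exp (\<alpha> * t) = (max c 0 + 1 / x) / (1 / x + v)"
            by (simp add: nonzero_eq_divide_eq)
          then have "\<alpha> * t = ln ((max c 0 + 1 / x) / (1 / x + v))"
            by (metis ln_exp)
          then show False using elim assms by (simp add: t0_def field_simps)
        qed
        moreover have "0 \<le> (exp (\<alpha> * t) - 1) / x + exp (\<alpha> * t) * v"
          using g real by simp
        ultimately show ?case using ennreal_eqD by metis
      qed
    qed
  qed
qed measurable

text \<open>Freeze the first holding time; the second sojourn has positive slope, so the previous
  lemma applies to the tail.\<close>

lemma AE_exp_functional_neq_neg: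
  assumes "0 < \<alpha> * x" "0 < \<beta>" "0 < y"
  shows "AE s in exp_seq. exp_functional \<alpha> \<beta> x y s \<noteq> ennreal c"
proof (subst AE_exp_seq_iter)
  show "AE t in std_exp. AE s in exp_seq. exp_functional \<alpha> \<beta> x y (case_nat t s) \<noteq> ennreal c"
    using AE_std_exp_pos
  proof eventually_elim
    case (elim t)
    let ?g = "(exp (\<alpha> * t) - 1) / x"
    have g: "0 \<le> ?g" using assms elim by (intro exp_diff_div_nonneg) auto
    show ?case
      \<comment> \<open>The value that the tail must take for the whole functional to equal
        \<open>max c 0\<close>.\<close>
      using AE_exp_functional_neq_pos[of \<beta> y \<alpha> x "(max c 0 - ?g) / exp (\<alpha> * t)", OF assms(2,3)]
    proof eventually_elim
      case (elim s)
      show ?case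
      proof (cases "exp_functional \<beta> \<alpha> y x s")
        case top
        then show ?thesis by (simp add: exp_functional_case_nat ennreal_mult_top)
      next
        case (real v)
        have "exp_functional \<alpha> \<beta> x y (case_nat t s) = ennreal (?g + exp (\<alpha> * t) * v)"
          using real g by (simp add: exp_functional_case_nat ennreal_mult[symmetric])
        moreover have "?g + exp (\<alpha> * t) * v \<noteq> max c 0"
        proof
          assume "?g + exp (\<alpha> * t) * v = max c 0"
          then have "v = (max c 0 - ?g) / exp (\<alpha> * t)" by (simp add: nonzero_eq_divide_eq algebra_simps)
          then show False using elim real by simp
        qed
        moreover have "0 \<le> ?g + exp (\<alpha> * t) * v" using g real by simp
        ultimately show ?thesis using ennreal_eqD by metis
      qed
    qed
  qed
qed measurable

text \<open>A long first holding time in the contracting state brings the functional close to \<open>- 1 / x\<close>.\<close>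

lemma exp_functional_small_neg:
  assumes "\<alpha> + \<beta> < 0" "\<alpha> < 0" "x < 0" "0 < \<beta>" "0 < y" "- 1 / x < c"
  shows "\<not> (AE s in exp_seq. ennreal c \<le> exp_functional \<alpha> \<beta> x y s)"
proof
  assume "AE s in exp_seq. ennreal c \<le> exp_functional \<alpha> \<beta> x y s"
  then have "AE s in exp_seq. AE t in std_exp. ennreal c \<le> exp_functional \<alpha> \<beta> x y (case_nat t s)"
    by (subst (asm) AE_exp_seq_iter') measurable
  moreover have "AE s in exp_seq. exp_functional \<beta> \<alpha> y x s < \<infinity>"
    using assms by (intro AE_exp_functional_finite) (auto simp: mult_neg_neg)
  ultimately have "AE s in exp_seq. (AE t in std_exp. ennreal c \<le> exp_functional \<alpha> \<beta> x y (case_nat t s))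
      \<and> exp_functional \<beta> \<alpha> y x s < \<infinity>"
    by eventually_elim auto
  then obtain s where s: "AE t in std_exp. ennreal c \<le> exp_functional \<alpha> \<beta> x y (case_nat t s)"
    "exp_functional \<beta> \<alpha> y x s < \<infinity>"
    using eventually_happens exp_seq.P.ae_filter_bot by blast
  then obtain v where v: "0 \<le> v" "exp_functional \<beta> \<alpha> y x s = ennreal v"
    by (cases "exp_functional \<beta> \<alpha> y x s") auto
  \<comment> \<open>The functional as a function of the first holding time, with the tail value
    frozen; its limit is \<open>- 1 / x\<close>.\<close>
  define F where "F t = (exp (\<alpha> * t) - 1) / x + exp (\<alpha> * t) * v" for t
  have "((\<lambda>t. exp (\<alpha> * t)) \<longlongrightarrow> 0) at_top"
    using assms
    by (intro filterlim_compose[OF exp_at_bot] filterlim_tendsto_neg_mult_at_bot[OF tendsto_const _ filterlim_ident])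
  then have "(F \<longlongrightarrow> (0 - 1) / x + 0 * v) at_top"
    unfolding F_def using assms by (intro tendsto_intros) auto
  then have "\<forall>\<^sub>F t in at_top. F t < c"
    using assms by (intro order_tendstoD) auto
  then obtain u where u: "\<And>t. u \<le> t \<Longrightarrow> F t < c"
    by (auto simp: eventually_at_top_linorder)
  obtain t where t: "max u 0 < t" "ennreal c \<le> exp_functional \<alpha> \<beta> x y (case_nat t s)"
    using AE_std_exp_between[OF s(1), of "max u 0" "max u 0 + 1"] by auto
  have g: "0 \<le> (exp (\<alpha> * t) - 1) / x"
    using t assms by (intro exp_diff_div_nonneg) (auto simp: mult_neg_neg)
  then have "exp_functional \<alpha> \<beta> x y (case_nat t s) = ennreal (F t)"
    using v by (simp add: exp_functional_case_nat ennreal_mult[symmetric] F_def)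
  moreover have "0 \<le> F t" using g v by (simp add: F_def)
  ultimately have "c \<le> F t" using t by (simp add: ennreal_le_iff)
  then show False using u[of t] t by simp
qed

text \<open>A short first sojourn in the expanding state changes the functional arbitrarily little:
  \<open>F\<close> is continuous with \<open>F 0 = v\<close>. An almost sure lower bound would thus
  carry over to the start in the contracting state.\<close>

lemma exp_functional_small_pos:
  assumes "\<alpha> + \<beta> < 0" "\<alpha> < 0" "x < 0" "0 < \<beta>" "0 < y" "- 1 / x < c"
  shows "\<not> (AE s in exp_seq. ennreal c \<le> exp_functional \<beta> \<alpha> y x s)"
proof
  assume "AE s in exp_seq. ennreal c \<le> exp_functional \<beta> \<alpha> y x s"
  then have "AE s in exp_seq. AE t in std_exp. ennreal c \<le> exp_functional \<beta> \<alpha> y x (case_nat t s)"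
    by (subst (asm) AE_exp_seq_iter') measurable
  then have "AE s in exp_seq. ennreal c \<le> exp_functional \<alpha> \<beta> x y s"
  proof eventually_elim
    case (elim s)
    show ?case
    proof (cases "exp_functional \<alpha> \<beta> x y s")
      case (real v)
      define F where "F t = (exp (\<beta> * t) - 1) / y + exp (\<beta> * t) * v" for t
      have "c \<le> v"
      proof (rule ccontr)
        assume "\<not> c \<le> v"
        have "isCont F 0" unfolding F_def using assms by (intro continuous_intros) auto
        then have "(F \<longlongrightarrow> F 0) (at_right 0)"
          by (simp add: continuous_at filterlim_at_split)
        then have "\<forall>\<^sub>F t in at_right 0. F t < c"
          by (rule order_tendstoD(2)) (use \<open>\<not> c \<le> v\<close> in \<open>simp add: F_def\<close>)
        then obtain u where u: "0 < u" "\<And>t. 0 < t \<Longrightarrow> t < u \<Longrightarrow> F t < c"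
          unfolding eventually_at_right_field by auto
        obtain t where t: "0 < t" "t < u" "ennreal c \<le> exp_functional \<beta> \<alpha> y x (case_nat t s)"
          using AE_std_exp_between[OF elim, of 0 u] u by auto
        have g: "0 \<le> (exp (\<beta> * t) - 1) / y"
          using t assms by (intro exp_diff_div_nonneg) auto
        then have "exp_functional \<beta> \<alpha> y x (case_nat t s) = ennreal (F t)"
          using real by (simp add: exp_functional_case_nat ennreal_mult[symmetric] F_def)
        moreover have "0 \<le> F t" using g real by (simp add: F_def)
        ultimately have "c \<le> F t" using t by (simp add: ennreal_le_iff)
        then show False using u(2)[of t] t by simp
      qed
      then show ?thesis using real by (simp add: ennreal_leI)
    qed simp
  qed
  then show False using exp_functional_small_neg[OF assms] by contradiction
qed

section \<open>Single trajectories\<close>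

text \<open>Continuity of \<open>x\<close> upgrades the integral equation to a differential
  equation, which becomes linear in \<open>- 1 / x\<close>.\<close>

lemma bernoulli_step:
  fixes x :: "real \<Rightarrow> real"
  assumes "u \<le> v" "p \<noteq> 0" "x u < 0" "continuous_on {u..v} x"
    and sol: "\<And>t. t \<in> {u..v} \<Longrightarrow> ((\<lambda>s. p * x s - (x s)\<^sup>2) has_integral (x t - x u)) {u..t}"
  shows "x v < 0" "exp (p * (v - u)) / (- x v) = 1 / (- x u) - (exp (p * (v - u)) - 1) / p"
proof -
  have der: "(x has_real_derivative p * x t - (x t)\<^sup>2) (at t within {u..v})" if "t \<in> {u..v}" for t
  proof -
    have "((\<lambda>t. integral {u..t} (\<lambda>s. p * x s - (x s)\<^sup>2) + x u) has_real_derivative p * x t - (x t)\<^sup>2 + 0)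
        (at t within {u..v})"
      using assms(4) that
      by (intro derivative_intros integral_has_real_derivative continuous_intros)
    moreover have "integral {u..t} (\<lambda>s. p * x s - (x s)\<^sup>2) + x u = x t" if "t \<in> {u..v}" for t
      using integral_unique[OF sol[OF that]] by simp
    ultimately show ?thesis
      using that by (auto intro: has_field_derivative_transform_within[where d = 1])
  qed
  have uv: "u \<in> {u..v}" "v \<in> {u..v}" using assms(1) by auto
  \<comment> \<open>Written as \<open>x' = (p - x) * x\<close>, the equation is linear homogeneous
    with a continuous coefficient; the integrating factor shows that the sign persists.\<close>
  have neg: "x t < 0" if t: "t \<in> {u..v}" for t
  proof -
    define g where "g t = integral {u..t} (\<lambda>s. p - x s)" for t
    have "\<exists>c. \<forall>t\<in>{u..v}. x t * exp (- g t) = c"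
    proof (rule has_field_derivative_zero_constant)
      fix t assume t: "t \<in> {u..v}"
      have "(g has_real_derivative p - x t) (at t within {u..v})"
        unfolding g_def using assms(4) t
        by (intro integral_has_real_derivative continuous_intros)
      then show "((\<lambda>t. x t * exp (- g t)) has_real_derivative 0) (at t within {u..v})"
        by (auto intro!: derivative_eq_intros der[OF t] simp: algebra_simps power2_eq_square)
    qed simp
    then have "x t * exp (- g t) = x u * exp (- g u)" using uv t by metis
    then have "x t * exp (- g t) < 0" using assms(3) by (simp add: mult_neg_pos)
    then show ?thesis by (simp add: mult_less_0_iff)
  qed
  \<comment> \<open>A first integral: both terms have derivative
    \<open>exp (p * (t - u))\<close>.\<close>
  have "\<exists>c. \<forall>t\<in>{u..v}. exp (p * (t - u)) / x t - exp (p * (t - u)) / p = c"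
  proof (rule has_field_derivative_zero_constant)
    fix t assume t: "t \<in> {u..v}"
    show "((\<lambda>t. exp (p * (t - u)) / x t - exp (p * (t - u)) / p) has_real_derivative 0) (at t within {u..v})"
      using neg[OF t] assms(2)
      by (auto intro!: derivative_eq_intros der[OF t] simp: field_simps power2_eq_square)
  qed simp
  then have "exp (p * (v - u)) / x v - exp (p * (v - u)) / p = exp (p * (u - u)) / x u - exp (p * (u - u)) / p"
    using uv by metis
  then show "exp (p * (v - u)) / (- x v) = 1 / (- x u) - (exp (p * (v - u)) - 1) / p"
    by (simp add: diff_divide_distrib)
  show "x v < 0" using neg uv by simp
qed

section \<open>Hitting times and the pathwise setting\<close>

lemma hitting_time_less_infinity_iff:
  "hitting_time b x < \<infinity> \<longleftrightarrow> (\<exists>t\<ge>0. x t \<le> b)"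
  unfolding hitting_time_def Inf_less_iff by auto

lemma le_hitting_time:
  assumes "\<And>u. 0 \<le> u \<Longrightarrow> u \<le> t \<Longrightarrow> b < x u"
  shows "ereal t \<le> hitting_time b x"
  unfolding hitting_time_def using assms by (force intro!: Inf_greatest)

text \<open>Properties shared by almost every realisation, so that the analysis inside is
  deterministic. By \<open>jumps\<close> the sojourns cover the whole half-line.\<close>

locale switched_trajectory =
  fixes pm pp lm lp a :: real and s :: "nat \<Rightarrow> real" and e :: "real \<Rightarrow> int" and x :: "real \<Rightarrow> real"
  assumes pm: "pm < 0" and pp: "0 < pp" and lm: "0 < lm" and lp: "0 < lp"
    and s_pos: "0 < s k"
    and jumps: "filterlim (jump_time lm lp (e 0) s) at_top sequentially"
    and path: "switching_path lm lp s e"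
    and cont: "continuous_on {0..} x"
    and sol: "stopped_solution pm pp a e x"
    and neg0: "x 0 < 0"
    and stop_level: "a \<le> pm - 2"
begin

definition T :: "nat \<Rightarrow> real" where
  "T n = jump_time lm lp (e 0) s n"

definition p :: "nat \<Rightarrow> real" where
  "p n = rate pm pp ((-1) ^ n * e 0)"

text \<open>The exponent at the jump times.\<close>

definition B :: "nat \<Rightarrow> real" where
  "B n = (\<Sum>k<n. p k * s k / rate lm lp ((-1) ^ k * e 0))"

definition inc :: "nat \<Rightarrow> real" where
  "inc n = (exp (B (Suc n)) - exp (B n)) / p n"

text \<open>The exponent \<open>A\<^sub>t\<close>, for \<open>t\<close> in the \<open>n\<close>-th sojourn.\<close>

definition A :: "nat \<Rightarrow> real \<Rightarrow> real" where
  "A n t = B n + p n * (t - T n)"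

lemma rate_pos: "0 < rate lm lp i"
  using lm lp by (simp add: rate_def)

lemma p_cases: "p n = pm \<or> p n = pp"
  by (simp add: p_def rate_def)

lemma p_neq_0: "p n \<noteq> 0"
  using p_cases[of n] pm pp by auto

lemma T_0: "T 0 = 0"
  by (simp add: T_def jump_time_def)

lemma T_Suc: "T (Suc n) = T n + s n / rate lm lp ((-1) ^ n * e 0)"
  by (simp add: T_def jump_time_def)

lemma T_less_Suc: "T n < T (Suc n)"
  using s_pos[of n] rate_pos by (simp add: T_Suc)

lemma strict_mono_T: "strict_mono T"
  by (rule strict_monoI_Suc) (rule T_less_Suc)

lemma T_nonneg: "0 \<le> T n"
  using strict_mono_T T_0 by (metis strict_mono_less_eq le0)

lemma T_at_top: "filterlim T at_top sequentially"
  using jumps by (simp add: T_def[abs_def])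

lemma B_0: "B 0 = 0"
  by (simp add: B_def)

lemma A_end: "A n (T (Suc n)) = B (Suc n)"
  by (simp add: A_def B_def T_Suc)

lemma A_start: "A n (T n) = B n"
  by (simp add: A_def)

lemma e_eq: "T n \<le> t \<Longrightarrow> t < T (Suc n) \<Longrightarrow> e t = (-1) ^ n * e 0"
  using path unfolding switching_path_def T_def by blast

lemma sojourn_exists:
  assumes "0 \<le> t"
  obtains n where "T n \<le> t" "t < T (Suc n)"
proof -
  obtain N where "t < T N"
    using filterlim_at_top_dense[THEN iffD1, OF T_at_top, rule_format, of t]
    by (auto simp: eventually_sequentially)
  then have "t < T (LEAST n. t < T n)" by (rule LeastI)
  moreover have "(LEAST n. t < T n) \<noteq> 0" using calculation assms T_0 by (metis not_less)
  then obtain n where n: "(LEAST n. t < T n) = Suc n" using not0_implies_Suc by blast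
  moreover have "\<not> t < T n" using not_less_Least[of n "\<lambda>n. t < T n"] n by simp
  ultimately show ?thesis using that[of n] by simp
qed

section \<open>Explicit solution along the sojourns\<close>

definition alive :: "real \<Rightarrow> bool" where
  "alive t \<longleftrightarrow> (\<forall>u. 0 \<le> u \<longrightarrow> u \<le> t \<longrightarrow> a < x u)"

lemma alive_mono: "alive t \<Longrightarrow> u \<le> t \<Longrightarrow> alive u"
  by (simp add: alive_def)

lemma integral_equation:
  assumes "alive t" "0 \<le> t"
  shows "((\<lambda>s. switched_field pm pp (e s) (x s)) has_integral (x t - x 0)) {0..t}"
proof -
  \<comment> \<open>Level \<open>a\<close> is not reached by time \<open>t\<close>, so the stopped
    integral runs over all of \<open>{0..t}\<close>.\<close>
  have "ereal t \<le> hitting_time a x"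
    using assms by (intro le_hitting_time) (simp add: alive_def)
  then have "min (ereal t) (hitting_time a x) = ereal t" by (rule min_absorb1)
  then show ?thesis
    using sol assms(2) unfolding stopped_solution_def by (metis real_of_ereal.simps(1))
qed

lemma integral_equation_sojourn:
  assumes "alive v" "T n \<le> u" "u \<le> v" "v \<le> T (Suc n)"
  shows "((\<lambda>s. p n * x s - (x s)\<^sup>2) has_integral (x v - x u)) {u..v}"
proof -
  let ?f = "\<lambda>s. switched_field pm pp (e s) (x s)"
  have u: "0 \<le> u" using T_nonneg[of n] assms by simp
  have fv: "(?f has_integral (x v - x 0)) {0..v}"
    using assms u by (intro integral_equation) auto
  have fu: "(?f has_integral (x u - x 0)) {0..u}"
    using assms u by (intro integral_equation alive_mono[OF assms(1)]) auto
  have "?f integrable_on {u..v}"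
    by (rule integrable_on_subinterval[OF has_integral_integrable[OF fv]]) (use u in simp)
  moreover have "integral {u..v} ?f = x v - x u"
    using Henstock_Kurzweil_Integration.integral_combine[OF u assms(3) has_integral_integrable[OF fv]]
      integral_unique[OF fv] integral_unique[OF fu] by simp
  ultimately have "(?f has_integral (x v - x u)) {u..v}"
    by (metis integrable_integral)
  then show ?thesis
  \<comment> \<open>At \<open>T (Suc n)\<close> the chain has already switched; a single point does
    not affect the integral.\<close>
  proof (rule has_integral_spike_finite[rotated 2])
    fix t assume "t \<in> {u..v} - {T (Suc n)}"
    then have "e t = (-1) ^ n * e 0" using assms by (intro e_eq) auto
    then show "p n * x t - (x t)\<^sup>2 = ?f t"
      by (simp add: p_def switched_field_def rate_def)
  qed simp
qed

lemma sojourn_step: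
  assumes "alive t" "T n \<le> t" "t \<le> T (Suc n)"
    and "x (T n) < 0" "exp (B n) / (- x (T n)) = 1 / (- x 0) - sum inc {..<n}"
  shows "x t < 0"
    and "exp (A n t) / (- x t) = 1 / (- x 0) - sum inc {..<n} - (exp (A n t) - exp (B n)) / p n"
proof -
  have c: "continuous_on {T n..t} x"
    using cont T_nonneg[of n] by (auto intro: continuous_on_subset)
  have i: "((\<lambda>s. p n * x s - (x s)\<^sup>2) has_integral (x v - x (T n))) {T n..v}" if "v \<in> {T n..t}" for v
    using that assms by (intro integral_equation_sojourn alive_mono[OF assms(1)]) auto
  note step = bernoulli_step[where x = x, OF assms(2) p_neq_0 assms(4) c i]
  show "x t < 0" by (rule step(1))
  have "exp (A n t) / (- x t) = exp (B n) * (exp (p n * (t - T n)) / (- x t))"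
    by (simp add: A_def exp_add)
  also have "\<dots> = exp (B n) / (- x (T n)) - (exp (A n t) - exp (B n)) / p n"
    by (subst step(2)) (simp_all add: A_def exp_add right_diff_distrib)
  finally show "exp (A n t) / (- x t) = 1 / (- x 0) - sum inc {..<n} - (exp (A n t) - exp (B n)) / p n"
    using assms(5) by simp
qed

text \<open>Integrated form of \<open>(exp A Z)' = - exp A\<close> with \<open>Z = - 1 / x\<close>,
  obtained sojourn by sojourn.\<close>

lemma at_jump:
  assumes "alive (T n)"
  shows "x (T n) < 0 \<and> exp (B n) / (- x (T n)) = 1 / (- x 0) - sum inc {..<n}"
  using assms
proof (induction n)
  case 0
  then show ?case using neg0 by (simp add: T_0 B_0)
next
  case (Suc n)
  then have IH: "x (T n) < 0" "exp (B n) / (- x (T n)) = 1 / (- x 0) - sum inc {..<n}"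
    using T_less_Suc[of n] alive_mono by (auto simp: less_imp_le)
  show ?case
    using sojourn_step[OF Suc.prems _ _ IH] T_less_Suc[of n]
    by (simp add: A_end inc_def less_imp_le)
qed

text \<open>The whole current sojourn is subtracted and its remaining part added back, which eases
  comparison with the infinite sum.\<close>

lemma reciprocal_formula:
  assumes "alive t" "T n \<le> t" "t \<le> T (Suc n)"
  shows "x t < 0"
    and "exp (A n t) / (- x t) = 1 / (- x 0) - sum inc {..<Suc n} + (exp (B (Suc n)) - exp (A n t)) / p n"
  using sojourn_step[OF assms] at_jump[OF alive_mono[OF assms(1,2)]]
  by (auto simp: inc_def diff_divide_distrib)

text \<open>The quantity is the integral of \<open>exp A\<close> from \<open>t\<close> to the end of
  the sojourn.\<close>

lemma increment_nonneg:
  assumes "t \<le> T (Suc n)"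
  shows "0 \<le> (exp (B (Suc n)) - exp (A n t)) / p n"
proof -
  have diff: "B (Suc n) - A n t = p n * (T (Suc n) - t)"
    by (simp add: A_end[symmetric] A_def algebra_simps)
  have t: "0 \<le> T (Suc n) - t" using assms by simp
  show ?thesis
  proof (cases "p n = pm")
    case True
    then have "B (Suc n) \<le> A n t"
      using diff mult_nonpos_nonneg[of "p n", OF _ t] pm by simp
    then show ?thesis using True pm by (intro divide_nonpos_neg) auto
  next
    case False
    then have p: "p n = pp" using p_cases by blast
    then have "A n t \<le> B (Suc n)"
      using diff mult_nonneg_nonneg[of "p n", OF _ t] pp by simp
    then show ?thesis using p pp by (intro divide_nonneg_pos) auto
  qed
qed

lemma inc_nonneg: "0 \<le> inc n"
  using increment_nonneg[of "T n" n] T_less_Suc[of n] by (simp add: inc_def A_start less_imp_le)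

text \<open>Equality holds in state -1; in state 1 the left side is at most zero. Over successive
  sojourns the left sides telescope.\<close>

lemma increment_ge_drop:
  assumes "t \<le> T (Suc n)"
  shows "(exp (A n t) - exp (B (Suc n))) / (- pm) \<le> (exp (B (Suc n)) - exp (A n t)) / p n"
proof (cases "p n = pm")
  case True
  then show ?thesis using pm by (simp add: field_simps)
next
  case False
  then have "p n = pp" using p_cases by blast
  then have "exp (A n t) - exp (B (Suc n)) \<le> 0"
    using increment_nonneg[OF assms] pp by (simp add: zero_le_divide_iff)
  then have "(exp (A n t) - exp (B (Suc n))) / (- pm) \<le> 0" using pm by (intro divide_nonpos_pos) auto
  then show ?thesis using increment_nonneg[OF assms] by linarith
qed

text \<open>On a sojourn \<open>exp A\<close> is monotone, hence at least \<open>m\<close>.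
  Formally, factor out the smaller end value and use \<open>1 + z \<le> exp z\<close>.\<close>

lemma inc_ge:
  assumes "m \<le> exp (B n)" "m \<le> exp (B (Suc n))"
  shows "m * (T (Suc n) - T n) \<le> inc n"
proof -
  let ?d = "T (Suc n) - T n"
  have B: "B (Suc n) = B n + p n * ?d"
    using A_end[of n] by (simp add: A_def)
  have d: "0 \<le> ?d" using T_less_Suc[of n] by simp
  show ?thesis
  proof (cases "p n = pm")
    case True
    have "m * (- pm * ?d) \<le> exp (B (Suc n)) * (- pm * ?d)"
      using assms(2) pm d by (intro mult_right_mono) (auto simp: mult_nonpos_nonneg)
    also have "\<dots> \<le> exp (B (Suc n)) * (exp (- pm * ?d) - 1)"
      using exp_ge_add_one_self[of "- pm * ?d"] by (intro mult_left_mono, linarith, simp)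
    also have "\<dots> = exp (B n) - exp (B (Suc n))"
      using B True by (simp add: right_diff_distrib exp_add[symmetric])
    finally show ?thesis using pm True by (simp add: inc_def field_simps)
  next
    case False
    then have p: "p n = pp" using p_cases by blast
    have "m * (pp * ?d) \<le> exp (B n) * (pp * ?d)"
      using assms(1) pp d by (intro mult_right_mono) auto
    also have "\<dots> \<le> exp (B n) * (exp (pp * ?d) - 1)"
      using exp_ge_add_one_self[of "pp * ?d"] by (intro mult_left_mono, linarith, simp)
    also have "\<dots> = exp (B (Suc n)) - exp (B n)"
      using B p by (simp add: right_diff_distrib exp_add[symmetric])
    finally show ?thesis using pp p by (simp add: inc_def field_simps)
  qed
qed

section \<open>Escape and convergence of a trajectory\<close>

lemma hits_if_exponent_unbounded:
  assumes "summable (\<lambda>n. exp (- B n))"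
  shows "\<exists>t\<ge>0. x t \<le> pm - 1"
proof (rule ccontr)
  assume "\<not> ?thesis"
  \<comment> \<open>A path that misses \<open>pm - 1\<close> stays above the stopping level, so the
    explicit formula holds at all times.\<close>
  then have alive: "alive t" for t
    using stop_level by (force simp: alive_def)
  have "Bseq (\<lambda>n. exp (- B n))"
    using summable_LIMSEQ_zero[OF assms] by (intro convergent_imp_Bseq convergentI)
  then obtain K where K: "0 < K" "\<And>n. exp (- B n) \<le> K"
    by (auto simp: Bseq_def)
  have m: "1 / K \<le> exp (B n)" for n
    using K(2)[of n] K(1) by (simp add: exp_minus field_simps)
  \<comment> \<open>The integral grows at least linearly in time and eventually exceeds
    \<open>1 / (- x 0)\<close>, making the positive left side of the formula negative.\<close>
  have J: "1 / K * T n \<le> sum inc {..<n}" for n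
  proof (induction n)
    case (Suc n)
    then show ?case using inc_ge[OF m m, of n] by (simp add: algebra_simps)
  qed (simp add: T_0)
  obtain n where "K / (- x 0) < T n"
    using filterlim_at_top_dense[THEN iffD1, OF T_at_top, rule_format, of "K / (- x 0)"]
    by (auto simp: eventually_sequentially)
  then have "1 / (- x 0) < 1 / K * T n" using K by (simp add: field_simps)
  also note J[of n]
  finally have "exp (B n) / (- x (T n)) < 0" using at_jump[OF alive, of n] by simp
  moreover have "0 < exp (B n) / (- x (T n))"
    using at_jump[OF alive, of n] by (intro divide_pos_pos) auto
  ultimately show False by simp
qed

lemma sum_inc_le:
  assumes "summable inc"
  shows "sum inc {..<n} \<le> suminf inc"
  using assms by (intro sum_le_suminf) (auto intro: inc_nonneg)

lemma hits_or_tendsto: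
  assumes "summable (\<lambda>n. exp (B n))" "summable inc" "suminf inc \<noteq> 1 / (- x 0)"
  shows "(\<exists>t\<ge>0. x t \<le> pm - 1) \<or> (x \<longlongrightarrow> 0) at_top"
proof (rule disjCI)
  assume not_zero: "\<not> (x \<longlongrightarrow> 0) at_top"
  show "\<exists>t\<ge>0. x t \<le> pm - 1"
  proof (rule ccontr)
    assume "\<not> ?thesis"
    then have alive: "alive t" for t
      using stop_level by (force simp: alive_def)
    \<comment> \<open>A lower bound for \<open>exp A / (- x)\<close> at all times, positive because
      equality is excluded. Hence \<open>- x\<close> is at most \<open>exp A / \<delta>\<close>,
      which tends to zero.\<close>
    define \<delta> where "\<delta> = 1 / (- x 0) - suminf inc"
    have "suminf inc \<le> 1 / (- x 0)"
    proof (rule suminf_le_const[OF assms(2)])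
      fix n
      have "0 \<le> exp (B n) / (- x (T n))"
        using at_jump[OF alive, of n] by (intro divide_nonneg_pos) auto
      then show "sum inc {..<n} \<le> 1 / (- x 0)" using at_jump[OF alive, of n] by simp
    qed
    then have \<delta>: "0 < \<delta>" using assms(3) by (simp add: \<delta>_def)
    have bound: "- x t \<le> max (exp (B n)) (exp (B (Suc n))) / \<delta>" "x t < 0"
      if t: "T n \<le> t" "t \<le> T (Suc n)" for n t
    proof -
      show neg: "x t < 0" using reciprocal_formula(1)[OF alive t] .
      have "\<delta> \<le> exp (A n t) / (- x t)"
        using reciprocal_formula(2)[OF alive t] increment_nonneg[OF t(2)] sum_inc_le[OF assms(2), of "Suc n"]
        by (simp add: \<delta>_def)
      then have le: "\<delta> * (- x t) \<le> exp (A n t)" using neg by (simp add: field_simps)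
      have "A n t \<le> max (B n) (B (Suc n))"
      proof (cases "0 \<le> p n")
        case True
        then have "A n t \<le> A n (T (Suc n))" using t by (simp add: A_def mult_left_mono)
        then show ?thesis by (simp add: A_end)
      next
        case False
        then have "A n t \<le> B n" using t by (simp add: A_def mult_nonpos_nonneg)
        then show ?thesis by simp
      qed
      then have "exp (A n t) \<le> max (exp (B n)) (exp (B (Suc n)))"
        by (auto simp: max_def split: if_splits)
      with le show "- x t \<le> max (exp (B n)) (exp (B (Suc n))) / \<delta>"
        using \<delta> by (simp add: field_simps)
    qed
    have "(x \<longlongrightarrow> 0) at_top"
    proof (rule tendstoI)
      fix \<epsilon> :: real assume \<epsilon>: "0 < \<epsilon>"
      have "\<forall>\<^sub>F n in sequentially. exp (B n) < \<epsilon> * \<delta>"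
        using summable_LIMSEQ_zero[OF assms(1)] by (rule order_tendstoD) (use \<epsilon> \<delta> in simp)
      then obtain N where N: "\<And>n. N \<le> n \<Longrightarrow> exp (B n) < \<epsilon> * \<delta>"
        by (auto simp: eventually_sequentially)
      have "dist (x t) 0 < \<epsilon>" if t: "T N \<le> t" for t
      proof -
        obtain n where n: "T n \<le> t" "t < T (Suc n)"
          using sojourn_exists[OF order_trans[OF T_nonneg[of N] t]] by blast
        have "T N < T (Suc n)" using n t by simp
        then have "N \<le> n" using strict_mono_T by (simp add: strict_mono_less)
        then have "max (exp (B n)) (exp (B (Suc n))) / \<delta> < \<epsilon>"
          using N[of n] N[of "Suc n"] \<delta> by (simp add: field_simps)
        then show ?thesis using bound[of n t] n by (simp add: dist_real_def)
      qed
      then show "\<forall>\<^sub>F t in at_top. dist (x t) 0 < \<epsilon>"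
        unfolding eventually_at_top_linorder by blast
    qed
    then show False using not_zero by contradiction
  qed
qed

text \<open>The tail of the functional from any time \<open>t\<close> on is at least \<open>exp A\<^sub>t / \<bar>p\<^sub>-\<bar>\<close>, its value when the
  chain stays in \<open>-1\<close> forever. Hence a solution that does not explode stays above \<open>p\<^sub>-\<close>.\<close>

lemma tail_ge:
  assumes "summable (\<lambda>n. exp (B n))" "summable inc"
  shows "exp (B n) / (- pm) \<le> suminf inc - sum inc {..<n}"
proof -
  have "(exp (B n) - exp (B (n + m))) / (- pm) \<le> sum inc {..<n + m} - sum inc {..<n}" for m
  proof (induction m)
    case (Suc m)
    have "(exp (B (n + m)) - exp (B (Suc (n + m)))) / (- pm) \<le> inc (n + m)"
      using increment_ge_drop[of "T (n + m)" "n + m"] T_less_Suc[of "n + m"]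
      by (simp add: A_start inc_def less_imp_le)
    with Suc show ?case by (simp add: diff_divide_distrib)
  qed simp
  then have "(exp (B n) - exp (B (n + m))) / (- pm) \<le> suminf inc - sum inc {..<n}" for m
    by (rule order_trans) (simp add: sum_inc_le[OF assms(2)])
  moreover have "(\<lambda>m. (exp (B n) - exp (B (n + m))) / (- pm)) \<longlonglongrightarrow> (exp (B n) - 0) / (- pm)"
  proof (intro tendsto_intros)
    show "(\<lambda>m. exp (B (n + m))) \<longlonglongrightarrow> 0"
      using LIMSEQ_ignore_initial_segment[OF summable_LIMSEQ_zero[OF assms(1)], of n]
      by (simp add: add.commute)
  qed (use pm in simp)
  ultimately show ?thesis
    by (intro LIMSEQ_le_const2[of _ "exp (B n) / (- pm)"]) auto
qed

lemma stays_above: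
  assumes "summable (\<lambda>n. exp (B n))" "summable inc" "suminf inc < 1 / (- x 0)" "alive t" "0 \<le> t"
  shows "pm < x t"
proof -
  obtain n where n: "T n \<le> t" "t < T (Suc n)" using sojourn_exists assms(5) by blast
  have n': "t \<le> T (Suc n)" using n by simp
  have neg: "x t < 0" by (rule reciprocal_formula(1)[OF assms(4) n(1) n'])
  \<comment> \<open>The right side of the formula is the positive gap
    \<open>1 / (- x 0) - suminf inc\<close>, plus the tail after this sojourn, plus the rest of this
    sojourn. The last two add up to at least \<open>exp (A n t) / (- pm)\<close>.\<close>
  have "exp (A n t) / (- pm) < exp (A n t) / (- x t)"
    using reciprocal_formula(2)[OF assms(4) n(1) n'] increment_ge_drop[OF n'] tail_ge[OF assms(1,2), of "Suc n"] assms(3)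
    by (simp add: diff_divide_distrib)
  then have "- x t < - pm" using neg pm
    by (simp add: frac_less2 divide_less_cancel field_simps mult_less_cancel_left)
  then show ?thesis by simp
qed

text \<open>The bound \<open>pm < x t\<close> is available while the path is alive. At the first
  passage to \<open>pm - 1\<close> it is still above \<open>a\<close>, so the bound contradicts the
  value there.\<close>

lemma not_hits:
  assumes "summable (\<lambda>n. exp (B n))" "summable inc" "suminf inc < 1 / (- x 0)"
  shows "\<not> (\<exists>t\<ge>0. x t \<le> pm - 1)"
proof
  assume ex: "\<exists>t\<ge>0. x t \<le> pm - 1"
  \<comment> \<open>At index 0 the tail bound says that the whole integral is at least
    \<open>1 / (- pm)\<close>.\<close>
  have x0: "pm < x 0"
  proof -
    have "1 / (- pm) < 1 / (- x 0)"
      using tail_ge[OF assms(1,2), of 0] assms(3) by (simp add: B_0)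
    then show ?thesis using neg0 pm by (simp add: field_simps)
  qed
  obtain t where t: "0 \<le> t" "x t = pm - 1" "\<And>u. 0 \<le> u \<Longrightarrow> u < t \<Longrightarrow> pm - 1 < x u"
  proof -
    let ?S = "{0..} \<inter> x -` {..pm - 1}"
    have "closed ?S" using cont by (intro continuous_closed_preimage) auto
    have ne: "?S \<noteq> {}" "bdd_below ?S" using ex by (auto intro: bdd_belowI[of _ 0])
    then have in_S: "Inf ?S \<in> ?S" using \<open>closed ?S\<close> by (intro closed_contains_Inf)
    have before: "pm - 1 < x u" if "0 \<le> u" "u < Inf ?S" for u
      using cInf_lower[of u ?S] ne that by (force simp: not_le)
    \<comment> \<open>The infimum only gives \<open>x \<le> pm - 1\<close>; the intermediate value
      theorem gives equality, at a time that minimality identifies with the infimum.\<close>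
    obtain v where v: "0 \<le> v" "v \<le> Inf ?S" "x v = pm - 1"
      using IVT2'[of x "Inf ?S" "pm - 1" 0] in_S x0 continuous_on_subset[OF cont, of "{0..Inf ?S}"]
      by auto
    then have "v = Inf ?S" using before[of v] by force
    then show ?thesis using that v before by blast
  qed
  have "alive t"
    unfolding alive_def
  proof (intro allI impI)
    fix u assume "0 \<le> u" "u \<le> t"
    then have "pm - 1 \<le> x u" using t(2) t(3)[of u] by (cases "u = t") auto
    then show "a < x u" using stop_level by simp
  qed
  then show False using stays_above[OF assms _ t(1)] t(2) by simp
qed

end

section \<open>The switched process\<close>

lemma jump_time_eq:
  "jump_time lm lp i s n = alternating_sum (1 / rate lm lp i) (1 / rate lm lp (- i)) s n"
  unfolding jump_time_def alternating_sum_def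
  by (rule sum.cong) auto

definition drift_ratio :: "real \<Rightarrow> real \<Rightarrow> real \<Rightarrow> real \<Rightarrow> int \<Rightarrow> real" where
  "drift_ratio pm pp lm lp i = rate pm pp i / rate lm lp i"

definition switched_functional :: "real \<Rightarrow> real \<Rightarrow> real \<Rightarrow> real \<Rightarrow> int \<Rightarrow> (nat \<Rightarrow> real) \<Rightarrow> ennreal" where
  "switched_functional pm pp lm lp i =
     exp_functional (drift_ratio pm pp lm lp i) (drift_ratio pm pp lm lp (- i)) (rate pm pp i) (rate pm pp (- i))"

lemma drift_ratio_add:
  assumes "i \<in> {-1, 1::int}"
  shows "drift_ratio pm pp lm lp i + drift_ratio pm pp lm lp (- i) = pm / lm + pp / lp"
  using assms by (auto simp: drift_ratio_def rate_def)

lemma alternating_sum_uminus: "alternating_sum (- \<alpha>) (- \<beta>) s n = - alternating_sum \<alpha> \<beta> s n"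
  unfolding alternating_sum_def sum_negf[symmetric] by (rule sum.cong) auto

context switched_trajectory
begin

abbreviation "\<alpha> \<equiv> drift_ratio pm pp lm lp (e 0)"
abbreviation "\<beta> \<equiv> drift_ratio pm pp lm lp (- e 0)"

lemma B_eq: "B n = alternating_sum \<alpha> \<beta> s n"
  unfolding B_def alternating_sum_def
  by (rule sum.cong) (auto simp: p_def drift_ratio_def)

lemma inc_eq: "inc n = exp_increment \<alpha> \<beta> (rate pm pp (e 0)) (rate pm pp (- e 0)) s n"
  by (simp add: inc_def exp_increment_def B_eq p_def)

lemma summable_inc:
  assumes "summable (\<lambda>n. exp (B n))"
  shows "summable inc"
proof -
  have "summable (exp_increment \<alpha> \<beta> (rate pm pp (e 0)) (rate pm pp (- e 0)) s)"
    using assms pm pp by (intro summable_exp_increment) (auto simp: B_eq rate_def)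
  then show ?thesis by (simp add: inc_eq[abs_def])
qed

lemma functional_eq:
  assumes "summable (\<lambda>n. exp (B n))"
  shows "switched_functional pm pp lm lp (e 0) s = ennreal (suminf inc)"
proof -
  have "switched_functional pm pp lm lp (e 0) s = (\<Sum>n. ennreal (inc n))"
    by (simp add: switched_functional_def exp_functional_def inc_eq)
  also have "\<dots> = ennreal (suminf inc)"
    by (intro suminf_ennreal2 inc_nonneg summable_inc assms)
  finally show ?thesis .
qed

end

text \<open>Jump times are alternating sums with positive coefficients. Negating these gives a
  negative total, so \<open>exp (- jump_time lm lp i s n)\<close> is summable and the jump times
  diverge.\<close>

lemma AE_jump_times_at_top:
  assumes "0 < lm" "0 < lp"
  shows "AE s in exp_seq. filterlim (jump_time lm lp i s) at_top sequentially"
proof -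
  have "0 < 1 / rate lm lp j" for j using assms by (simp add: rate_def)
  from this[of i] this[of "- i"]
  have "AE s in exp_seq. summable (\<lambda>n. exp (alternating_sum (- (1 / rate lm lp i)) (- (1 / rate lm lp (- i))) s n))"
    by (intro AE_summable_exp_alternating_sum) linarith
  then show ?thesis
  proof eventually_elim
    case (elim s)
    then have "(\<lambda>n. exp (- jump_time lm lp i s n)) \<longlonglongrightarrow> 0"
      by (simp add: summable_LIMSEQ_zero alternating_sum_uminus jump_time_eq)
    then have "filterlim (\<lambda>n. exp (- jump_time lm lp i s n)) (at_right 0) sequentially"
      by (simp add: filterlim_at)
    then have "filterlim (\<lambda>n. ln (exp (- jump_time lm lp i s n))) at_bot sequentially"
      by (rule filterlim_compose[OF ln_at_0])
    then show ?case by (simp add: filterlim_uminus_at_bot)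
  qed
qed

lemma measurable_switched_functional [measurable]:
  "switched_functional pm pp lm lp i \<in> borel_measurable (PiM UNIV (\<lambda>_::nat. borel))"
  unfolding switched_functional_def by measurable

lemma AE_switched_functional_neq:
  assumes "pm < 0" "0 < pp" "0 < lm" "0 < lp" "i \<in> {-1, 1}"
  shows "AE s in exp_seq. switched_functional pm pp lm lp i s \<noteq> ennreal c"
proof (cases "i = 1")
  case True
  then show ?thesis
    unfolding switched_functional_def using assms
    by (intro AE_exp_functional_neq_pos) (auto simp: drift_ratio_def rate_def)
next
  case False
  then show ?thesis
    unfolding switched_functional_def using assms
    by (intro AE_exp_functional_neq_neg) (auto simp: drift_ratio_def rate_def mult_neg_neg divide_neg_pos)
qed

lemma switched_functional_small:
  assumes "pm < 0" "0 < pp" "0 < lm" "0 < lp" "i \<in> {-1, 1}" "pm / lm + pp / lp < 0" "- 1 / pm < c"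
  shows "\<not> (AE s in exp_seq. ennreal c \<le> switched_functional pm pp lm lp i s)"
proof (cases "i = 1")
  case True
  then show ?thesis
    unfolding switched_functional_def using assms
    by (simp add: drift_ratio_def rate_def) (intro exp_functional_small_pos; simp add: divide_neg_pos)
next
  case False
  then have "i = -1" using assms by auto
  then show ?thesis
    unfolding switched_functional_def using assms
    by (simp add: drift_ratio_def rate_def) (intro exp_functional_small_neg; simp add: divide_neg_pos)
qed

section \<open>Measurability of the events\<close>

lemma sets_ge_on_closure:
  fixes Y :: "real \<Rightarrow> 'w \<Rightarrow> real"
  assumes "open S"
    and "\<And>t. t \<in> S \<Longrightarrow> Y t \<in> borel_measurable M"
    and "\<And>\<omega>. \<omega> \<in> space M \<Longrightarrow> continuous_on (closure S) (\<lambda>t. Y t \<omega>)"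
  shows "{\<omega> \<in> space M. \<forall>t\<in>closure S. c \<le> Y t \<omega>} \<in> sets M"
proof -
  have cl: "closure (S \<inter> \<rat>) = closure S"
    using assms(1) by (intro closure_open_Int_superset) (auto simp: Rats_closure_real)
  \<comment> \<open>Continuity reduces the uncountable quantifier to rational times, dense in the
    closure because \<open>S\<close> is open.\<close>
  have "{\<omega> \<in> space M. \<forall>t\<in>closure S. c \<le> Y t \<omega>} = {\<omega> \<in> space M. \<forall>t\<in>S \<inter> \<rat>. c \<le> Y t \<omega>}"
  proof (intro Collect_cong conj_cong refl iffI ballI)
    fix \<omega> t assume \<omega>: "\<omega> \<in> space M" "\<forall>t\<in>S \<inter> \<rat>. c \<le> Y t \<omega>" "t \<in> closure S"
    show "c \<le> Y t \<omega>"
      by (rule continuous_ge_on_closure[of "S \<inter> \<rat>" "\<lambda>t. Y t \<omega>"])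
        (use \<omega> assms(3) cl in auto)
  qed (use closure_subset in blast)
  also have "\<dots> \<in> sets M"
  proof (rule sets.sets_Collect_countable_All')
    fix t assume "t \<in> S \<inter> \<rat>"
    then have [measurable]: "Y t \<in> borel_measurable M" using assms(2) by simp
    show "{\<omega> \<in> space M. c \<le> Y t \<omega>} \<in> sets M" by measurable
  qed (simp add: countable_rat countable_Int2)
  finally show ?thesis .
qed

context stopped_switched_process
begin

lemma sets_hits: "{\<omega> \<in> space M. hitting_time b (\<lambda>t. X t \<omega>) < \<infinity>} \<in> sets M"
proof -
  \<comment> \<open>By compactness, never reaching \<open>b\<close> means staying a positive
    distance above it on each bounded interval. \<open>Suc N\<close> keeps the open interval
    nonempty, so that its closure is the closed one.\<close>
  have iff: "hitting_time b (\<lambda>t. X t \<omega>) < \<infinity> \<longleftrightarrow>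
      \<not> (\<forall>N::nat. \<exists>k::nat. \<forall>t\<in>closure {0<..<real (Suc N)}. b + 1 / real (Suc k) \<le> X t \<omega>)"
    if \<omega>: "\<omega> \<in> space M" for \<omega>
  proof -
    have "(\<forall>N::nat. \<exists>k::nat. \<forall>t\<in>{0..real (Suc N)}. b + 1 / real (Suc k) \<le> X t \<omega>)" if no: "\<not> (\<exists>t\<ge>0. X t \<omega> \<le> b)"
    proof
      fix N :: nat
      have "continuous_on {0..real (Suc N)} (\<lambda>t. X t \<omega>)"
        using X_continuous[OF \<omega>] by (rule continuous_on_subset) auto
      then obtain t where t: "t \<in> {0..real (Suc N)}" "\<And>u. u \<in> {0..real (Suc N)} \<Longrightarrow> X t \<omega> \<le> X u \<omega>"
        using continuous_attains_inf[of "{0..real (Suc N)}" "\<lambda>t. X t \<omega>"] by auto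
      moreover have "0 \<le> t" using t by simp
      ultimately have "0 < X t \<omega> - b" using no by (metis diff_gt_0_iff_gt not_le)
      then obtain k where "1 / real (Suc k) < X t \<omega> - b" using nat_approx_posE by blast
      then have "\<forall>u\<in>{0..real (Suc N)}. b + 1 / real (Suc k) \<le> X u \<omega>" using t(2) by force
      then show "\<exists>k. \<forall>u\<in>{0..real (Suc N)}. b + 1 / real (Suc k) \<le> X u \<omega>" by blast
    qed
    moreover have "b < X t \<omega>"
      if all: "\<forall>N::nat. \<exists>k::nat. \<forall>t\<in>{0..real (Suc N)}. b + 1 / real (Suc k) \<le> X t \<omega>" and t: "0 \<le> t" for t
    proof -
      obtain N where "t \<le> real N" using real_arch_simple by blast
      then obtain k :: nat where k: "b + 1 / real (Suc k) \<le> X t \<omega>"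
        using all t by (force dest: spec[of _ N])
      have "0 < 1 / real (Suc k)" by simp
      then show ?thesis using k by linarith
    qed
    ultimately show ?thesis
      unfolding hitting_time_less_infinity_iff
      by (simp add: closure_greaterThanLessThan del: of_nat_Suc) (meson not_le)
  qed
  have [measurable]: "{\<omega> \<in> space M. \<forall>t\<in>closure {0<..<real (Suc N)}. c \<le> X t \<omega>} \<in> sets M" for N c
    by (rule sets_ge_on_closure)
      (auto intro!: X_measurable continuous_on_subset[OF X_continuous] simp: closure_greaterThanLessThan)
  have "{\<omega> \<in> space M. \<not> (\<forall>N::nat. \<exists>k::nat. \<forall>t\<in>closure {0<..<real (Suc N)}. b + 1 / real (Suc k) \<le> X t \<omega>)} \<in> sets M"
    by measurable
  then show ?thesis using iff by (simp cong: conj_cong)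
qed

text \<open>Countably many tolerances and starting times suffice; the modulus is bounded through its
  negative to match \<open>sets_ge_on_closure\<close>.\<close>

lemma sets_tendsto_zero: "{\<omega> \<in> space M. ((\<lambda>t. X t \<omega>) \<longlongrightarrow> 0) at_top} \<in> sets M"
proof -
  have iff: "((\<lambda>t. X t \<omega>) \<longlongrightarrow> 0) at_top \<longleftrightarrow>
      (\<forall>k::nat. \<exists>N::nat. \<forall>t\<in>closure {real N<..}. - (1 / real (Suc k)) \<le> - \<bar>X t \<omega>\<bar>)" for \<omega>
  proof
    assume lim: "((\<lambda>t. X t \<omega>) \<longlongrightarrow> 0) at_top"
    show "\<forall>k::nat. \<exists>N::nat. \<forall>t\<in>closure {real N<..}. - (1 / real (Suc k)) \<le> - \<bar>X t \<omega>\<bar>"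
    proof
      fix k :: nat
      have "\<forall>\<^sub>F t in at_top. \<bar>X t \<omega>\<bar> < 1 / real (Suc k)"
        using tendstoD[OF lim, of "1 / real (Suc k)"] by simp
      then obtain u where u: "\<And>t. u \<le> t \<Longrightarrow> \<bar>X t \<omega>\<bar> < 1 / real (Suc k)"
        by (auto simp: eventually_at_top_linorder)
      obtain N where "u \<le> real N" using real_arch_simple by blast
      then have "\<forall>t\<in>closure {real N<..}. - (1 / real (Suc k)) \<le> - \<bar>X t \<omega>\<bar>"
        using less_imp_le[OF u] by (simp add: closure_greaterThan)
      then show "\<exists>N::nat. \<forall>t\<in>closure {real N<..}. - (1 / real (Suc k)) \<le> - \<bar>X t \<omega>\<bar>"
        by blast
    qed
  next
    assume all: "\<forall>k::nat. \<exists>N::nat. \<forall>t\<in>closure {real N<..}. - (1 / real (Suc k)) \<le> - \<bar>X t \<omega>\<bar>"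
    show "((\<lambda>t. X t \<omega>) \<longlongrightarrow> 0) at_top"
    proof (rule tendstoI)
      fix \<epsilon> :: real assume "0 < \<epsilon>"
      then obtain k where k: "1 / real (Suc k) < \<epsilon>" using nat_approx_posE by blast
      obtain N where N: "\<forall>t\<in>closure {real N<..}. - (1 / real (Suc k)) \<le> - \<bar>X t \<omega>\<bar>" using all by blast
      show "\<forall>\<^sub>F t in at_top. dist (X t \<omega>) 0 < \<epsilon>"
        unfolding eventually_at_top_linorder
        by (rule exI[of _ "real N"]) (use N k in \<open>force simp: closure_greaterThan simp del: of_nat_Suc\<close>)
    qed
  qed
  have [measurable]: "{\<omega> \<in> space M. \<forall>t\<in>closure {real N<..}. c \<le> - \<bar>X t \<omega>\<bar>} \<in> sets M" for N c
    by (rule sets_ge_on_closure)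
      (auto intro!: X_measurable continuous_on_subset[OF X_continuous] continuous_intros
        borel_measurable_uminus borel_measurable_abs simp: closure_greaterThan)
  show ?thesis unfolding iff by measurable
qed

end

section \<open>Transfer from the law of the start and the holding variables\<close>

lemma distr_pair_snd_prob:
  assumes "prob_space N" "prob_space L"
  shows "distr (N \<Otimes>\<^sub>M L) L snd = L"
proof (rule measure_eqI)
  interpret N: prob_space N by fact
  interpret L: prob_space L by fact
  fix A assume "A \<in> sets (distr (N \<Otimes>\<^sub>M L) L snd)"
  then have A: "A \<in> sets L" by simp
  then have "snd -` A \<inter> space (N \<Otimes>\<^sub>M L) = space N \<times> A"
    using sets.sets_into_space[OF A] by (auto simp: space_pair_measure)
  then show "emeasure (distr (N \<Otimes>\<^sub>M L) L snd) A = emeasure L A"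
    using A by (simp add: emeasure_distr L.emeasure_pair_measure_Times N.emeasure_space_1)
qed simp

locale negative_process = stopped_switched_process +
  assumes pm: "pm < 0" and pp: "0 < pp" and lm: "0 < lm" and lp: "0 < lp"
    and stop_level: "a \<le> pm - 2"
    and prob_space_\<nu>: "prob_space \<nu>" and sets_\<nu>: "sets \<nu> = sets state_space"
    and \<nu>_neg: "measure \<nu> ({..<0} \<times> {-1, 1}) = 1"
begin

sublocale init: prob_space \<nu> by (rule prob_space_\<nu>)

sublocale init_seq: pair_prob_space \<nu> exp_seq by unfold_locales

declare sets_\<nu> [measurable_cong]

lemma space_\<nu>: "space \<nu> = UNIV \<times> {-1, 1}"
  using sets_eq_imp_space_eq[OF sets_\<nu>] by (simp add: space_pair_measure)

lemma AE_\<nu>_neg: "AE z in \<nu>. fst z < 0"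
proof -
  have "AE z in \<nu>. z \<in> {..<0} \<times> {-1, 1}"
    using init.AE_in_set_eq_1[of "{..<0} \<times> {-1, 1}"] \<nu>_neg by (simp add: sets_\<nu>)
  then show ?thesis by eventually_elim auto
qed

lemma start_state: "\<omega> \<in> space M \<Longrightarrow> E 0 \<omega> \<in> {-1, 1}"
  using measurable_space[OF E_measurable[of 0]] by simp

text \<open>The driving variables are only asserted to exist; one sequence is fixed here.\<close>

definition S :: "nat \<Rightarrow> 'a \<Rightarrow> real" where
  "S = (SOME S. (\<forall>n. S n \<in> borel_measurable M) \<and>
      distr M (state_space \<Otimes>\<^sub>M PiM UNIV (\<lambda>n::nat. borel)) (\<lambda>\<omega>. ((X 0 \<omega>, E 0 \<omega>), \<lambda>n. S n \<omega>)) = \<nu> \<Otimes>\<^sub>M exp_seq \<and>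
      (AE \<omega> in M. switching_path lm lp (\<lambda>n. S n \<omega>) (\<lambda>t. E t \<omega>)))"

lemma S_measurable: "S n \<in> borel_measurable M"
  and S_law: "distr M (state_space \<Otimes>\<^sub>M PiM UNIV (\<lambda>n::nat. borel)) (\<lambda>\<omega>. ((X 0 \<omega>, E 0 \<omega>), \<lambda>n. S n \<omega>)) = \<nu> \<Otimes>\<^sub>M exp_seq"
  and S_path: "AE \<omega> in M. switching_path lm lp (\<lambda>n. S n \<omega>) (\<lambda>t. E t \<omega>)"
  using someI_ex[OF joint_law] unfolding S_def[symmetric] by blast+

lemma measurable_data [measurable]:
  "(\<lambda>\<omega>. ((X 0 \<omega>, E 0 \<omega>), \<lambda>n. S n \<omega>)) \<in> M \<rightarrow>\<^sub>M state_space \<Otimes>\<^sub>M PiM UNIV (\<lambda>n::nat. borel)"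
proof -
  note [measurable] = X_measurable[OF order_refl] E_measurable[OF order_refl] S_measurable
  show ?thesis
    by (intro measurable_Pair measurable_PiM_single') (auto simp: S_measurable)
qed

lemma AE_dataD:
  assumes "AE z in \<nu> \<Otimes>\<^sub>M exp_seq. Q z"
  shows "AE \<omega> in M. Q ((X 0 \<omega>, E 0 \<omega>), \<lambda>n. S n \<omega>)"
  using assms by (intro AE_distrD[OF measurable_data]) (simp only: S_law)

lemma AE_startD:
  assumes "AE z in \<nu>. Q z"
  shows "AE \<omega> in M. Q (X 0 \<omega>, E 0 \<omega>)"
proof -
  have "AE z in distr (\<nu> \<Otimes>\<^sub>M exp_seq) \<nu> fst. Q z"
    using assms by (simp only: exp_seq.P.distr_pair_fst)
  then have "AE z in \<nu> \<Otimes>\<^sub>M exp_seq. Q (fst z)"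
    by (rule AE_distrD[OF measurable_fst])
  then show ?thesis by (auto dest: AE_dataD)
qed

lemma AE_seqD:
  assumes "AE s in exp_seq. Q s"
  shows "AE \<omega> in M. Q (\<lambda>n. S n \<omega>)"
proof -
  have "AE z in distr (\<nu> \<Otimes>\<^sub>M exp_seq) exp_seq snd. Q z"
    by (subst distr_pair_snd_prob[OF prob_space_\<nu> exp_seq.P.prob_space_axioms]) (rule assms)
  then have "AE z in \<nu> \<Otimes>\<^sub>M exp_seq. Q (snd z)"
    by (rule AE_distrD[OF measurable_snd])
  then show ?thesis by (auto dest: AE_dataD)
qed

lemma AE_trajectory:
  "AE \<omega> in M. switched_trajectory pm pp lm lp a (\<lambda>n. S n \<omega>) (\<lambda>t. E t \<omega>) (\<lambda>t. X t \<omega>)"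
  using AE_seqD[OF AE_exp_seq_pos] AE_seqD[OF AE_jump_times_at_top[OF lm lp, of 1]]
    AE_seqD[OF AE_jump_times_at_top[OF lm lp, of "-1"]] S_path X_solution AE_startD[OF AE_\<nu>_neg] AE_space
proof eventually_elim
  case (elim \<omega>)
  then show ?case
    using start_state[of \<omega>] X_continuous[of \<omega>] pm pp lm lp stop_level
    by unfold_locales auto
qed

text \<open>The initial state is random but has two values, so the result for both fixed states
  suffices. A general \<open>f\<close> serves drift ratios and their negatives.\<close>

lemma AE_summable_exp:
  assumes "\<And>i. i \<in> {-1, 1::int} \<Longrightarrow> f i + f (- i) < 0"
  shows "AE \<omega> in M. summable (\<lambda>n. exp (alternating_sum (f (E 0 \<omega>)) (f (- E 0 \<omega>)) (\<lambda>n. S n \<omega>) n))"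
proof -
  have "AE \<omega> in M. summable (\<lambda>n. exp (alternating_sum (f i) (f (- i)) (\<lambda>n. S n \<omega>) n))"
    if "i \<in> {-1, 1}" for i
    by (rule AE_seqD, rule AE_summable_exp_alternating_sum, rule assms, rule that)
  from this[of 1, simplified] this[of "-1", simplified] AE_space show ?thesis
  proof eventually_elim
    case (elim \<omega>)
    then show ?case using start_state[of \<omega>] by auto
  qed
qed

section \<open>The two drift regimes\<close>

lemma AE_hits:
  assumes "0 < pm / lm + pp / lp"
  shows "AE \<omega> in M. hitting_time (pm - 1) (\<lambda>t. X t \<omega>) < \<infinity>"
proof -
  have "- drift_ratio pm pp lm lp i + - drift_ratio pm pp lm lp (- i) < 0" if "i \<in> {-1, 1}" for i
    using drift_ratio_add[OF that, of pm pp lm lp] assms by simp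
  then have "AE \<omega> in M. summable (\<lambda>n. exp (alternating_sum (- drift_ratio pm pp lm lp (E 0 \<omega>))
      (- drift_ratio pm pp lm lp (- E 0 \<omega>)) (\<lambda>n. S n \<omega>) n))"
    by (rule AE_summable_exp)
  then show ?thesis
    using AE_trajectory
  proof eventually_elim
    case (elim \<omega>)
    then interpret switched_trajectory pm pp lm lp a "\<lambda>n. S n \<omega>" "\<lambda>t. E t \<omega>" "\<lambda>t. X t \<omega>" by blast
    show ?case
      unfolding hitting_time_less_infinity_iff
      by (rule hits_if_exponent_unbounded) (use elim in \<open>simp add: B_eq alternating_sum_uminus\<close>)
  qed
qed

lemma measurable_start_functional [measurable]:
  "(\<lambda>z. switched_functional pm pp lm lp (snd (fst z)) (snd z)) \<in> borel_measurable (\<nu> \<Otimes>\<^sub>M exp_seq)"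
proof -
  have "(\<lambda>z. if snd (fst z) = -1 then switched_functional pm pp lm lp (-1) (snd z)
      else switched_functional pm pp lm lp 1 (snd z)) \<in> borel_measurable (\<nu> \<Otimes>\<^sub>M exp_seq)"
    by measurable
  then show ?thesis
    by (rule measurable_cong[THEN iffD1, rotated]) (auto simp: space_pair_measure space_\<nu>)
qed

text \<open>The start is independent of the holding variables, so by Fubini the critical value
  \<open>1 / (- X 0 \<omega>)\<close> may be treated as a constant.\<close>

lemma AE_functional_neq:
  "AE \<omega> in M. switched_functional pm pp lm lp (E 0 \<omega>) (\<lambda>n. S n \<omega>) \<noteq> ennreal (1 / (- X 0 \<omega>))"
proof -
  have "AE z in \<nu> \<Otimes>\<^sub>M exp_seq.
      switched_functional pm pp lm lp (snd (fst z)) (snd z) \<noteq> ennreal (1 / (- fst (fst z)))"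
  proof (rule init_seq.AE_pair_measure)
    show "AE x in \<nu>. AE s in exp_seq. switched_functional pm pp lm lp (snd (fst (x, s))) (snd (x, s))
        \<noteq> ennreal (1 / (- fst (fst (x, s))))"
    proof (rule AE_I2)
      fix x assume "x \<in> space \<nu>"
      then have "snd x \<in> {-1, 1}" by (auto simp: space_\<nu>)
      from AE_switched_functional_neq[OF pm pp lm lp this, of "1 / (- fst x)"]
      show "AE s in exp_seq. switched_functional pm pp lm lp (snd (fst (x, s))) (snd (x, s))
          \<noteq> ennreal (1 / (- fst (fst (x, s))))"
        by simp
    qed
  qed measurable
  then show ?thesis by (auto dest: AE_dataD)
qed

context
  assumes drift_neg: "pm / lm + pp / lp < 0"
begin

lemma AE_summable_exponent:
  "AE \<omega> in M. summable (\<lambda>n. exp (alternating_sum (drift_ratio pm pp lm lp (E 0 \<omega>))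
      (drift_ratio pm pp lm lp (- E 0 \<omega>)) (\<lambda>n. S n \<omega>) n))"
  by (rule AE_summable_exp) (use drift_ratio_add[of _ pm pp lm lp] drift_neg in simp)

lemma AE_hits_or_tendsto:
  "AE \<omega> in M. hitting_time (pm - 1) (\<lambda>t. X t \<omega>) < \<infinity> \<or> ((\<lambda>t. X t \<omega>) \<longlongrightarrow> 0) at_top"
  using AE_summable_exponent AE_trajectory AE_functional_neq
proof eventually_elim
  case (elim \<omega>)
  then interpret switched_trajectory pm pp lm lp a "\<lambda>n. S n \<omega>" "\<lambda>t. E t \<omega>" "\<lambda>t. X t \<omega>" by blast
  have sum: "summable (\<lambda>n. exp (B n))" using elim by (simp add: B_eq)
  show ?case
    unfolding hitting_time_less_infinity_iff
    using elim(3) by (intro hits_or_tendsto sum summable_inc) (auto simp: functional_eq[OF sum])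
qed

text \<open>Almost sure hitting would force the functional to be at least
  \<open>1 / (- X 0 \<omega>)\<close> almost surely. From a start between \<open>pm\<close> and 0
  this value exceeds \<open>- 1 / pm\<close>, and the functional falls below it with positive
  probability, so such starts would form a null set.\<close>

lemma not_AE_hits:
  assumes "0 < measure \<nu> ({pm<..<0} \<times> {-1, 1})"
  shows "\<not> (AE \<omega> in M. hitting_time (pm - 1) (\<lambda>t. X t \<omega>) < \<infinity>)"
proof
  let ?Q = "\<lambda>z. ennreal (1 / (- fst (fst z))) \<le> switched_functional pm pp lm lp (snd (fst z)) (snd z)"
  assume "AE \<omega> in M. hitting_time (pm - 1) (\<lambda>t. X t \<omega>) < \<infinity>"
  then have "AE \<omega> in M. ?Q ((X 0 \<omega>, E 0 \<omega>), \<lambda>n. S n \<omega>)"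
    using AE_summable_exponent AE_trajectory
  proof eventually_elim
    case (elim \<omega>)
    then interpret switched_trajectory pm pp lm lp a "\<lambda>n. S n \<omega>" "\<lambda>t. E t \<omega>" "\<lambda>t. X t \<omega>" by blast
    have sum: "summable (\<lambda>n. exp (B n))" using elim by (simp add: B_eq)
    have "\<not> suminf inc < 1 / (- X 0 \<omega>)"
      using not_hits[OF sum summable_inc[OF sum]] elim(1)
      unfolding hitting_time_less_infinity_iff by blast
    then have "1 / (- X 0 \<omega>) \<le> suminf inc" by (rule leI)
    then show ?case by (simp add: functional_eq[OF sum] ennreal_leI)
  qed
  \<comment> \<open>The inequality involves the start and the holding variables alone, so it can be
    read under the product law and then for a fixed start.\<close>
  then have "AE z in distr M (state_space \<Otimes>\<^sub>M PiM UNIV (\<lambda>n::nat. borel))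
      (\<lambda>\<omega>. ((X 0 \<omega>, E 0 \<omega>), \<lambda>n. S n \<omega>)). ?Q z"
    by (subst AE_distr_iff) (use measurable_data in measurable)
  then have "AE z in \<nu> \<Otimes>\<^sub>M exp_seq. ?Q z" by (simp only: S_law)
  then have "AE x in \<nu>. AE s in exp_seq. ?Q (x, s)"
    by (rule init_seq.AE_pair)
  then have "AE x in \<nu>. x \<notin> {pm<..<0} \<times> {-1, 1}"
  proof eventually_elim
    case (elim x)
    show ?case
    proof
      assume x: "x \<in> {pm<..<0} \<times> {-1, 1}"
      then have "- 1 / pm < 1 / (- fst x)" using pm by (auto simp: field_simps)
      then have "\<not> (AE s in exp_seq. ennreal (1 / (- fst x)) \<le> switched_functional pm pp lm lp (snd x) s)"
        using x by (intro switched_functional_small[OF pm pp lm lp _ drift_neg]) auto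
      then show False using elim by simp
    qed
  qed
  then have "measure \<nu> ({pm<..<0} \<times> {-1, 1}) = 0"
    by (subst (asm) AE_iff_measurable[of "{pm<..<0} \<times> {-1, 1}"]) (auto simp: sets_\<nu> space_\<nu> measure_def)
  then show False using assms by simp
qed

end

end

theorem theorem3p7:
  fixes pm pp lm lp a :: real
    and \<nu> :: "(real \<times> int) measure"
    and M :: "'w measure"
    and X :: "real \<Rightarrow> 'w \<Rightarrow> real"
    and E :: "real \<Rightarrow> 'w \<Rightarrow> int"
  assumes "pm < 0" and "0 < pp" and "0 < lm" and "0 < lp"
    and "a \<le> pm - 2"
    and "prob_space \<nu>" and "sets \<nu> = sets state_space"
    and "measure \<nu> ({..<0} \<times> {-1, 1}) = 1"
    and "stopped_switched_process M pm pp lm lp a \<nu> X E"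
  shows "(lp / pp < - (lm / pm) \<longrightarrow>
      \<P>(\<omega> in M. hitting_time (pm - 1) (\<lambda>t. X t \<omega>) < \<infinity>) = 1) \<and>
    (lp / pp > - (lm / pm) \<and> measure \<nu> ({pm<..<0} \<times> {-1, 1}) > 0 \<longrightarrow>
      {\<omega> \<in> space M. hitting_time (pm - 1) (\<lambda>t. X t \<omega>) < \<infinity>} \<in> sets M \<and>
      \<P>(\<omega> in M. hitting_time (pm - 1) (\<lambda>t. X t \<omega>) < \<infinity>) < 1 \<and>
      \<P>(\<omega> in M. hitting_time (pm - 1) (\<lambda>t. X t \<omega>) < \<infinity>
                  \<or> ((\<lambda>t. X t \<omega>) \<longlongrightarrow> 0) at_top) = 1)"
proof -
  interpret negative_process M pm pp lm lp a \<nu> X E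
    by (intro negative_process.intro negative_process_axioms.intro assms)
  let ?hit = "\<lambda>\<omega>. hitting_time (pm - 1) (\<lambda>t. X t \<omega>) < \<infinity>"
  \<comment> \<open>The left side is the mean change of the exponent over one cycle of the chain.
    The prefactor on the right is negative, so the comparison of the theorem is reversed.\<close>
  have drift: "pm / lm + pp / lp = (pp * pm / (lm * lp)) * (lp / pp - - (lm / pm))"
    using pm pp lm lp by (simp add: field_simps)
  have neg: "pp * pm / (lm * lp) < 0"
    using pm pp lm lp by (simp add: divide_neg_pos mult_pos_neg)
  show ?thesis
  proof (intro conjI impI)
    assume "lp / pp < - (lm / pm)"
    then have "0 < pm / lm + pp / lp"
      unfolding drift using neg by (intro mult_neg_neg) auto
    then show "\<P>(\<omega> in M. ?hit \<omega>) = 1"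
      using AE_hits prob_Collect_eq_1[OF sets_hits] by blast
  next
    show "{\<omega> \<in> space M. ?hit \<omega>} \<in> sets M" by (rule sets_hits)
  next
    assume *: "- (lm / pm) < lp / pp \<and> 0 < measure \<nu> ({pm<..<0} \<times> {-1, 1})"
    then have d: "pm / lm + pp / lp < 0"
      unfolding drift using neg by (intro mult_neg_pos) auto
    have "\<P>(\<omega> in M. ?hit \<omega>) \<noteq> 1"
      using not_AE_hits[OF d] * prob_Collect_eq_1[OF sets_hits] by blast
    then show "\<P>(\<omega> in M. ?hit \<omega>) < 1" using prob_le_1 less_le by blast
    have "{\<omega> \<in> space M. ?hit \<omega> \<or> ((\<lambda>t. X t \<omega>) \<longlongrightarrow> 0) at_top} \<in> sets M"
      by (intro sets.sets_Collect_disj sets_hits sets_tendsto_zero)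
    from prob_Collect_eq_1[OF this] AE_hits_or_tendsto[OF d]
    show "\<P>(\<omega> in M. ?hit \<omega> \<or> ((\<lambda>t. X t \<omega>) \<longlongrightarrow> 0) at_top) = 1"
      by blast
  qed
qed

end
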